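(* Every finitely generated group embeds quasi-isometrically (with respect to word metrics from finite generating sets) as a subgroup of a simple group that can be generated by two elements.
   Context: A group is simple if it is nontrivial and has no normal subgroups other than itself and the trivial subgroup. An injective homomorphism $H\to K$ of finitely generated groups is a quasi-isometric embedding if there are $C,D>0$ with $\frac1C d(x,y)-D\le d(f(x),f(y))\le C d(x,y)+D$ for the word metrics. *)

theory Defs
  imports "HOL-Algebra.Algebra" "HOL-Analysis.Analysis"
begin

text \<open>A group is simple if it is nontrivial and its only normal subgroups are itself
  and the trivial subgroup. (The library locale simple_group demands order G > 1,
  which fails for infinite groups since card of an infinite set is 0, so we define
  the notion directly.)\<close>
definition simple_grp :: "('a, 'b) monoid_scheme \<Rightarrow> bool" where
  "simple_grp G \<longleftrightarrow> group G \<and> carrier G \<noteq> {\<one>\<^bsub>G\<^esub>} \<and>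
     (\<forall>N. N \<lhd> G \<longrightarrow> N = {\<one>\<^bsub>G\<^esub>} \<or> N = carrier G)"

definition fin_gen_set :: "('a, 'b) monoid_scheme \<Rightarrow> 'a set \<Rightarrow> bool" where
  "fin_gen_set G S \<longleftrightarrow> finite S \<and> S \<subseteq> carrier G \<and> generate G S = carrier G"

definition finitely_generated :: "('a, 'b) monoid_scheme \<Rightarrow> bool" where
  "finitely_generated G \<longleftrightarrow> (\<exists>S. fin_gen_set G S)"

definition word_length :: "('a, 'b) monoid_scheme \<Rightarrow> 'a set \<Rightarrow> 'a \<Rightarrow> nat" where
  "word_length G S x = (LEAST n. \<exists>ws. length ws = n \<and>
      set ws \<subseteq> S \<union> (\<lambda>s. inv\<^bsub>G\<^esub> s) ` S \<and> foldr (\<otimes>\<^bsub>G\<^esub>) ws \<one>\<^bsub>G\<^esub> = x)"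

definition word_dist :: "('a, 'b) monoid_scheme \<Rightarrow> 'a set \<Rightarrow> 'a \<Rightarrow> 'a \<Rightarrow> real" where
  "word_dist G S x y = real (word_length G S (inv\<^bsub>G\<^esub> x \<otimes>\<^bsub>G\<^esub> y))"

definition qi_embedding ::
  "('a, 'b) monoid_scheme \<Rightarrow> 'a set \<Rightarrow> ('c, 'd) monoid_scheme \<Rightarrow> 'c set \<Rightarrow> ('a \<Rightarrow> 'c) \<Rightarrow> bool" where
  "qi_embedding H S G T f \<longleftrightarrow> (\<exists>C D::real. C > 0 \<and> D > 0 \<and>
     (\<forall>x\<in>carrier H. \<forall>y\<in>carrier H.
        word_dist H S x y / C - D \<le> word_dist G T (f x) (f y) \<and>
        word_dist G T (f x) (f y) \<le> C * word_dist H S x y + D))"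

end

theory Submission
  imports Defs
begin

text \<open>
  Let \<open>\<Omega> = H \<times> \<int>\<close>, take the alphabet \<open>\<Omega> \<times> {0, \<dots>, n - 1}\<close> and let \<open>W\<close> be the set of infinite words that
  are eventually equal to a base letter. The group \<open>\<Gamma>\<close> consists of permutations of \<open>W\<close> that are locally
  replacements of one prefix by another. It is generated by the cyclic shift of the \<open>n\<close> classes of letters
  and by finitely many three-cycles, each of which lies in an alternating group that permutes five disjoint
  copies of a subset of \<open>W\<close>.

  \<^item> Two generators: a three-cycle is a commutator of three-cycles. Spread all of them over the classes of
    letters at sparse (Sidon) distances to form one element; its translates by powers of the shift have
    supports that meet in a single window, so their commutators recover each three-cycle.
  \<^item> Simplicity: a nontrivial element \<open>h\<close> of a normal subgroup moves some cone off itself, so the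
    subgroup contains all commutators of elements supported there. The supports of the three-cycles
    can be compressed into any cone, hence the subgroup contains them, and the shift, being a cycle
    of odd length, is a product of three-cycles of classes.
  \<^item> The embedding: \<open>h \<in> H\<close> acts on \<open>\<Omega>\<close> on the left on the level \<open>H \<times> {0}\<close>. This is the commutator of
    the shift of levels with the action of \<open>h\<close> on all levels \<open>k \<ge> 0\<close> (the swindle that avoids
    any obstruction from the abelianization of \<open>H\<close>), which is why it lies in \<open>\<Gamma>\<close>.
  \<^item> No distortion: let \<open>\<pi>\<close> multiply the \<open>H\<close>-components of the letters of a word. Every generator of \<open>\<Gamma>\<close>
    changes \<open>\<pi>\<close> by left multiplication by elements of bounded length, whereas \<open>h\<close> changes it by \<open>h\<close>.
\<close>

section \<open>Word lengths\<close>

context group begin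

lemma foldr_mult_closed:
  "set ws \<subseteq> carrier G \<Longrightarrow> foldr (\<otimes>) ws \<one> \<in> carrier G"
  by (induction ws) auto

lemma foldr_mult_append:
  assumes "set us \<subseteq> carrier G" "set vs \<subseteq> carrier G"
  shows "foldr (\<otimes>) (us @ vs) \<one> = foldr (\<otimes>) us \<one> \<otimes> foldr (\<otimes>) vs \<one>"
  using assms by (induction us) (auto simp: foldr_mult_closed m_assoc)

lemma foldr_mult_rev_inv:
  assumes "set ws \<subseteq> carrier G"
  shows "foldr (\<otimes>) (map (\<lambda>s. inv s) (rev ws)) \<one> = inv (foldr (\<otimes>) ws \<one>)"
  using assms
proof (induction ws)
  case (Cons x xs)
  then have "set (map (\<lambda>s. inv s) (rev xs)) \<subseteq> carrier G" by auto
  then show ?case using Cons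
    by (simp add: foldr_mult_append foldr_mult_closed inv_mult_group del: foldr_append)
qed simp

definition word_for :: "'a set \<Rightarrow> 'a list \<Rightarrow> 'a \<Rightarrow> bool" where
  "word_for S ws x \<longleftrightarrow> set ws \<subseteq> S \<union> (\<lambda>s. inv s) ` S \<and> foldr (\<otimes>) ws \<one> = x"

lemma word_length_eq: "word_length G S x = (LEAST n. \<exists>ws. length ws = n \<and> word_for S ws x)"
  unfolding word_length_def word_for_def ..

lemma word_length_le: "word_for S ws x \<Longrightarrow> word_length G S x \<le> length ws"
  unfolding word_length_eq by (rule Least_le) auto

lemma word_for_mult:
  assumes "S \<subseteq> carrier G" "word_for S us x" "word_for S vs y"
  shows "word_for S (us @ vs) (x \<otimes> y)"
proof -
  have "S \<union> (\<lambda>s. inv s) ` S \<subseteq> carrier G" using assms(1) by auto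
  then have "set us \<subseteq> carrier G" "set vs \<subseteq> carrier G" using assms unfolding word_for_def by blast+
  with foldr_mult_append[of us vs] show ?thesis using assms unfolding word_for_def by simp
qed

lemma word_for_inv:
  assumes "S \<subseteq> carrier G" "word_for S ws x"
  shows "word_for S (map (\<lambda>s. inv s) (rev ws)) (inv x)"
proof -
  have 1: "set ws \<subseteq> S \<union> (\<lambda>s. inv s) ` S" using assms unfolding word_for_def by auto
  then have "set ws \<subseteq> carrier G" using assms by auto
  moreover have "set (map (\<lambda>s. inv s) (rev ws)) \<subseteq> S \<union> (\<lambda>s. inv s) ` S"
    using 1 assms(1) by (fastforce simp: subset_iff)
  ultimately show ?thesis using assms foldr_mult_rev_inv[of ws] unfolding word_for_def by auto
qed

lemma word_for_exists:
  assumes "S \<subseteq> carrier G" "x \<in> generate G S"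
  shows "\<exists>ws. word_for S ws x"
  using assms(2)
proof induction
  case one
  have "word_for S [] \<one>" unfolding word_for_def by auto
  then show ?case ..
next
  case (incl h)
  then have "word_for S [h] h" using assms(1) unfolding word_for_def by auto
  then show ?case ..
next
  case (inv h)
  then have "word_for S [inv h] (inv h)" using assms(1) unfolding word_for_def by auto
  then show ?case ..
next
  case (eng x y)
  then show ?case using word_for_mult[OF assms(1)] by blast
qed

lemma word_length_attained:
  assumes "fin_gen_set G S" "x \<in> carrier G"
  obtains ws where "word_for S ws x" "length ws = word_length G S x"
proof -
  have "\<exists>n ws. length ws = n \<and> word_for S ws x"
    using word_for_exists assms unfolding fin_gen_set_def by auto
  from LeastI_ex[OF this] show ?thesis using that unfolding word_length_eq by auto
qed

lemma word_length_one: "word_length G S \<one> = 0"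
  using word_length_le[of S "[]" \<one>] by (simp add: word_for_def)

lemma word_length_mult:
  assumes "fin_gen_set G S" "x \<in> carrier G" "y \<in> carrier G"
  shows "word_length G S (x \<otimes> y) \<le> word_length G S x + word_length G S y"
proof -
  obtain us vs where "word_for S us x" "length us = word_length G S x"
    "word_for S vs y" "length vs = word_length G S y"
    using word_length_attained[OF assms(1,2)] word_length_attained[OF assms(1,3)] by metis
  moreover have "S \<subseteq> carrier G" using assms(1) unfolding fin_gen_set_def by simp
  ultimately show ?thesis
    using word_length_le[OF word_for_mult, of S us x vs y] by simp
qed

lemma word_length_inv_le:
  assumes "fin_gen_set G S" "x \<in> carrier G"
  shows "word_length G S (inv x) \<le> word_length G S x"
proof -
  obtain ws where "word_for S ws x" "length ws = word_length G S x"
    using word_length_attained[OF assms] .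
  moreover have "S \<subseteq> carrier G" using assms(1) unfolding fin_gen_set_def by simp
  ultimately show ?thesis
    using word_length_le[OF word_for_inv, of S ws x] by simp
qed

lemma word_length_inv:
  assumes "fin_gen_set G S" "x \<in> carrier G"
  shows "word_length G S (inv x) = word_length G S x"
  using word_length_inv_le[OF assms] word_length_inv_le[OF assms(1), of "inv x"] assms(2) by auto

text \<open>\<open>Bd g c\<close> is to be read as ``\<open>g\<close> has length at most \<open>c\<close>'' for a subadditive length.\<close>

lemma length_bound_lipschitz:
  assumes T: "fin_gen_set G T"
    and Bd_one: "Bd \<one> (0::nat)"
    and Bd_mult: "\<And>g g' c c'. g \<in> carrier G \<Longrightarrow> g' \<in> carrier G \<Longrightarrow> Bd g c \<Longrightarrow> Bd g' c' \<Longrightarrow> Bd (g \<otimes> g') (c + c')"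
    and Bd_mono: "\<And>g c c'. Bd g c \<Longrightarrow> c \<le> c' \<Longrightarrow> Bd g c'"
    and Bd_ex: "\<And>g. g \<in> carrier G \<Longrightarrow> \<exists>c. Bd g c"
  shows "\<exists>K. \<forall>g\<in>carrier G. Bd g (K * word_length G T g)"
proof -
  define U where "U = T \<union> (\<lambda>s. inv s) ` T"
  have U: "finite U" "U \<subseteq> carrier G" using T unfolding fin_gen_set_def U_def by auto
  obtain b where b: "\<And>g. g \<in> carrier G \<Longrightarrow> Bd g (b g)" using Bd_ex by metis
  \<comment> \<open>Inserting 0 keeps the maximum defined when \<open>T\<close>, and with it
    \<open>U\<close>, is empty.\<close>
  define K where "K = Max (insert 0 (b ` U))"
  have K: "Bd g K" if "g \<in> U" for g
    using Bd_mono[OF b] that U unfolding K_def by (meson Max_ge finite_imageI finite_insert imageI insertI2 subsetD)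
  have "Bd (foldr (\<otimes>) ws \<one>) (K * length ws)" if "set ws \<subseteq> U" for ws
    using that
  proof (induction ws)
    case (Cons x xs)
    then show ?case using Bd_mult[OF _ _ K[of x], of "foldr (\<otimes>) xs \<one>"] U(2)
      by (simp add: foldr_mult_closed subset_trans subset_iff)
  qed (simp add: Bd_one)
  then have "Bd g (K * word_length G T g)" if "g \<in> carrier G" for g
    using word_length_attained[OF T that] unfolding word_for_def U_def by metis
  then show ?thesis by blast
qed

end

text \<open>The length of the image is subadditive on \<open>H\<close>, so the preceding bound
  applies to it. For the identity map this compares two finite generating sets of one group.\<close>

lemma hom_word_length_lipschitz:
  assumes "group H" "group G" "f \<in> hom H G" "fin_gen_set H S" "fin_gen_set G T"
  shows "\<exists>K. \<forall>h\<in>carrier H. word_length G T (f h) \<le> K * word_length H S h"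
proof -
  interpret H: group H by fact
  interpret G: group G by fact
  interpret f: group_hom H G f using assms(3) by unfold_locales
  show ?thesis
  proof (rule H.length_bound_lipschitz[OF assms(4), where Bd = "\<lambda>h c. word_length G T (f h) \<le> c"])
    fix g g' c c' assume a: "g \<in> carrier H" "g' \<in> carrier H" "word_length G T (f g) \<le> c" "word_length G T (f g') \<le> c'"
    have "word_length G T (f (g \<otimes>\<^bsub>H\<^esub> g')) \<le> word_length G T (f g) + word_length G T (f g')"
      using a G.word_length_mult[OF assms(5), of "f g" "f g'"] by simp
    with a show "word_length G T (f (g \<otimes>\<^bsub>H\<^esub> g')) \<le> c + c'" by linarith
  qed (auto simp: G.word_length_one)
qed

text \<open>The upper bound holds for every homomorphism. The lower one chains three comparisons:
  the lengths over \<open>S\<close> and \<open>S'\<close>, the length over \<open>S'\<close> with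
  \<open>Bd\<close> through \<open>Bd_f\<close>, and \<open>Bd\<close> with the length over
  \<open>T\<close>. Letting \<open>S'\<close> differ from \<open>S\<close> means that distortion has
  to be excluded for a single generating set only.\<close>

lemma qi_embeddingI:
  assumes "group H" "group G" and f: "f \<in> hom H G" and S: "fin_gen_set H S" and S': "fin_gen_set H S'"
    and T: "fin_gen_set G T"
    and Bd_one: "Bd \<one>\<^bsub>G\<^esub> (0::nat)"
    and Bd_mult: "\<And>g g' c c'. g \<in> carrier G \<Longrightarrow> g' \<in> carrier G \<Longrightarrow> Bd g c \<Longrightarrow> Bd g' c' \<Longrightarrow> Bd (g \<otimes>\<^bsub>G\<^esub> g') (c + c')"
    and Bd_mono: "\<And>g c c'. Bd g c \<Longrightarrow> c \<le> c' \<Longrightarrow> Bd g c'"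
    and Bd_ex: "\<And>g. g \<in> carrier G \<Longrightarrow> \<exists>c. Bd g c"
    and Bd_f: "\<And>h c. h \<in> carrier H \<Longrightarrow> Bd (f h) c \<Longrightarrow> word_length H S' h \<le> c"
  shows "qi_embedding H S G T f"
proof -
  interpret H: group H by fact
  interpret G: group G by fact
  interpret f: group_hom H G f using f by unfold_locales
  obtain K1 where K1: "\<And>h. h \<in> carrier H \<Longrightarrow> word_length G T (f h) \<le> K1 * word_length H S h"
    using hom_word_length_lipschitz[OF assms(1,2) f S T] by auto
  have "(\<lambda>x. x) \<in> hom H H" by (auto simp: hom_def)
  from hom_word_length_lipschitz[OF assms(1,1) this S' S]
  obtain K2 where K2: "\<And>h. h \<in> carrier H \<Longrightarrow> word_length H S h \<le> K2 * word_length H S' h" by auto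
  obtain K3 where K3: "\<And>g. g \<in> carrier G \<Longrightarrow> Bd g (K3 * word_length G T g)"
    using G.length_bound_lipschitz[OF T, where Bd = Bd] Bd_one Bd_mult Bd_mono Bd_ex by metis
  \<comment> \<open>One constant serves both directions; the summand 1 keeps it positive, so that it
    can be divided by.\<close>
  define K where "K = K1 + K2 * K3 + 1"
  have upper: "word_length G T (f h) \<le> K * word_length H S h" if "h \<in> carrier H" for h
    using K1[OF that] unfolding K_def by (simp add: algebra_simps)
  have lower: "word_length H S h \<le> K * word_length G T (f h)" if "h \<in> carrier H" for h
  proof -
    have "word_length H S h \<le> K2 * word_length H S' h" using K2 that .
    also have "\<dots> \<le> K2 * (K3 * word_length G T (f h))"
      using Bd_f[OF that K3] that by simp
    also have "\<dots> \<le> K * word_length G T (f h)" unfolding K_def by (simp add: algebra_simps)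
    finally show ?thesis .
  qed
  have "word_dist H S x y / real K - 1 \<le> word_dist G T (f x) (f y) \<and>
      word_dist G T (f x) (f y) \<le> real K * word_dist H S x y + 1"
    if "x \<in> carrier H" "y \<in> carrier H" for x y
  proof -
    let ?h = "inv\<^bsub>H\<^esub> x \<otimes>\<^bsub>H\<^esub> y"
    have h: "?h \<in> carrier H" and fh: "inv\<^bsub>G\<^esub> f x \<otimes>\<^bsub>G\<^esub> f y = f ?h" using that by auto
    have "real (word_length H S ?h) \<le> real K * real (word_length G T (f ?h))"
      "real (word_length G T (f ?h)) \<le> real K * real (word_length H S ?h)"
      using lower[OF h] upper[OF h] by (simp_all flip: of_nat_mult)
    moreover have "real K > 0" unfolding K_def of_nat_0_less_iff by simp
    ultimately show ?thesis unfolding word_dist_def fh by (simp add: field_simps add_increasing2)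
  qed
  moreover have "real K > 0" unfolding K_def of_nat_0_less_iff by simp
  ultimately show ?thesis unfolding qi_embedding_def by (intro exI[of _ "real K"] exI[of _ 1]) auto
qed

section \<open>Transport to the natural numbers\<close>

lemma countable_generate:
  assumes "group G" "finite S" "S \<subseteq> carrier G"
  shows "countable (generate G S)"
proof -
  interpret group G by fact
  have "generate G S \<subseteq> (\<lambda>ws. foldr (\<otimes>\<^bsub>G\<^esub>) ws \<one>\<^bsub>G\<^esub>) ` lists (S \<union> (\<lambda>s. inv\<^bsub>G\<^esub> s) ` S)"
    using word_for_exists[OF assms(3)] unfolding word_for_def by (auto simp: image_iff lists_eq_set)
  moreover have "countable (lists (S \<union> (\<lambda>s. inv\<^bsub>G\<^esub> s) ` S))" using assms(2) by (simp add: countable_finite)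
  ultimately show ?thesis using countable_image countable_subset by metis
qed

text \<open>The simple group built below consists of permutations of lists, while the theorem asks
  for a carrier inside \<open>nat\<close>. The structure is transported along an enumeration, whose
  range may be a proper subset of \<open>nat\<close>.\<close>

lemma countable_group_iso_nat:
  assumes "group K" "countable (carrier K)"
  obtains G :: "nat monoid" and \<phi> where "group G" "\<phi> \<in> iso K G"
proof -
  interpret group K by fact
  define \<phi> where "\<phi> = to_nat_on (carrier K)"
  define \<psi> where "\<psi> = from_nat_into (carrier K)"
  have inj: "inj_on \<phi> (carrier K)" unfolding \<phi>_def using inj_on_to_nat_on[OF assms(2)] .
  have \<psi>: "\<psi> (\<phi> x) = x" if "x \<in> carrier K" for x
    using that assms(2) unfolding \<phi>_def \<psi>_def by simp
  define G where "G = \<lparr>carrier = \<phi> ` carrier K, monoid.mult = (\<lambda>x y. \<phi> (\<psi> x \<otimes>\<^bsub>K\<^esub> \<psi> y)), one = \<phi> \<one>\<^bsub>K\<^esub>\<rparr>"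
  have "group G"
  proof (rule groupI)
    fix x assume "x \<in> carrier G"
    then obtain k where "k \<in> carrier K" "x = \<phi> k" unfolding G_def by auto
    then show "\<exists>y\<in>carrier G. y \<otimes>\<^bsub>G\<^esub> x = \<one>\<^bsub>G\<^esub>"
      by (intro bexI[of _ "\<phi> (inv\<^bsub>K\<^esub> k)"]) (auto simp: G_def \<psi>)
  qed (auto simp: G_def \<psi> m_assoc)
  moreover have "\<phi> \<in> iso K G"
    unfolding iso_def hom_def bij_betw_def using inj by (auto simp: G_def \<psi>)
  ultimately show ?thesis using that by blast
qed

lemma simple_grp_iso:
  assumes "simple_grp K" "group G" "\<phi> \<in> iso K G"
  shows "simple_grp G"
proof -
  have K: "group K" using assms(1) unfolding simple_grp_def by auto
  interpret \<phi>: group_hom K G \<phi> using assms K by (simp add: group_hom_def group_hom_axioms_def iso_def)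
  have bij: "bij_betw \<phi> (carrier K) (carrier G)" using assms(3) unfolding iso_def by auto
  have inv: "inv_into (carrier K) \<phi> \<in> iso G K" using group.iso_set_sym[OF K assms(3)] .
  have "N = {\<one>\<^bsub>G\<^esub>} \<or> N = carrier G" if N: "N \<lhd> G" for N
  proof -
    let ?M = "inv_into (carrier K) \<phi> ` N"
    have "N \<subseteq> carrier G" using N normal_imp_subgroup subgroup.subset by blast
    then have im: "\<phi> ` ?M = N" using bij by (simp add: bij_betw_def image_inv_into_cancel)
    have "?M \<lhd> K" using iso_normal_subgroup[OF inv assms(2) K N] .
    then have "?M = {\<one>\<^bsub>K\<^esub>} \<or> ?M = carrier K" using assms(1) unfolding simple_grp_def by auto
    then show ?thesis
    proof
      assume "?M = {\<one>\<^bsub>K\<^esub>}"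
      then have "N = \<phi> ` {\<one>\<^bsub>K\<^esub>}" using im by simp
      then show ?thesis by simp
    next
      assume "?M = carrier K"
      then have "N = \<phi> ` carrier K" using im by simp
      then show ?thesis using bij by (simp add: bij_betw_def)
    qed
  qed
  moreover have "carrier G \<noteq> {\<one>\<^bsub>G\<^esub>}"
  proof
    assume "carrier G = {\<one>\<^bsub>G\<^esub>}"
    then have "\<phi> x = \<phi> \<one>\<^bsub>K\<^esub>" if "x \<in> carrier K" for x using that \<phi>.hom_closed by fastforce
    then have "carrier K = {\<one>\<^bsub>K\<^esub>}" using bij unfolding bij_betw_def inj_on_def by blast
    then show False using assms(1) unfolding simple_grp_def by auto
  qed
  ultimately show ?thesis using assms(2) unfolding simple_grp_def by blast
qed

section \<open>Permutation groups\<close>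

abbreviation pinv :: "('x \<Rightarrow> 'x) \<Rightarrow> 'x \<Rightarrow> 'x" where
  "pinv f \<equiv> inv_into UNIV f"

definition perm_grp :: "('x \<Rightarrow> 'x) monoid" where
  "perm_grp = \<lparr>carrier = {f. bij f}, monoid.mult = (\<circ>), one = id\<rparr>"

lemma perm_grp_simps [simp]:
  "carrier perm_grp = {f. bij f}" "f \<otimes>\<^bsub>perm_grp\<^esub> g = f \<circ> g" "\<one>\<^bsub>perm_grp\<^esub> = id"
  unfolding perm_grp_def by simp_all

lemma pinv_simps [simp]:
  "bij f \<Longrightarrow> pinv f (f x) = x" "bij f \<Longrightarrow> f (pinv f x) = x"
  "bij f \<Longrightarrow> pinv f \<circ> f = id" "bij f \<Longrightarrow> f \<circ> pinv f = id" "bij f \<Longrightarrow> bij (pinv f)"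
  by (auto simp: bij_is_inj bij_is_surj surj_f_inv_f bij_imp_bij_inv fun_eq_iff)

lemma group_perm_grp: "group (perm_grp :: ('x \<Rightarrow> 'x) monoid)"
proof (rule groupI)
  fix f :: "'x \<Rightarrow> 'x" assume "f \<in> carrier perm_grp"
  then show "\<exists>g\<in>carrier perm_grp. g \<otimes>\<^bsub>perm_grp\<^esub> f = \<one>\<^bsub>perm_grp\<^esub>"
    by (intro bexI[of _ "pinv f"]) auto
qed (auto simp: bij_comp comp_assoc)

interpretation perm: group "perm_grp :: ('x \<Rightarrow> 'x) monoid"
  by (rule group_perm_grp)

lemma perm_grp_inv [simp]: "bij f \<Longrightarrow> inv\<^bsub>perm_grp\<^esub> f = pinv f"
  by (rule perm.inv_equality) auto

lemma pinv_eqI: "bij f \<Longrightarrow> f \<circ> g = id \<Longrightarrow> pinv f = g"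
  by (metis comp_assoc comp_id id_comp pinv_simps(3))

lemma pinv_comp: "bij f \<Longrightarrow> bij g \<Longrightarrow> pinv (f \<circ> g) = pinv g \<circ> pinv f"
  by (rule o_inv_distrib)

lemma pinv_pinv: "bij f \<Longrightarrow> pinv (pinv f) = f"
  by (rule inv_inv_eq)

lemma pinv_id [simp]: "pinv id = id" by (rule inv_id)

section \<open>Setwise stabilizers and permutations of disjoint copies\<close>

definition stab :: "'j set \<Rightarrow> ('j \<Rightarrow> 'j) set" where
  "stab J = {p. bij p \<and> p ` J = J}"

lemma stab_id [simp]: "id \<in> stab J" unfolding stab_def by auto

lemma stab_comp: "p \<in> stab J \<Longrightarrow> p' \<in> stab J \<Longrightarrow> p \<circ> p' \<in> stab J"
  unfolding stab_def by (metis (mono_tags, lifting) bij_comp image_comp mem_Collect_eq)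

lemma stab_pinv: "p \<in> stab J \<Longrightarrow> pinv p \<in> stab J"
proof -
  assume p: "p \<in> stab J"
  then have "pinv p ` J = pinv p ` p ` J" unfolding stab_def by simp
  also have "\<dots> = J" using p unfolding stab_def image_comp by simp
  finally show ?thesis using p unfolding stab_def by simp
qed

lemma stab_bij: "p \<in> stab J \<Longrightarrow> bij p" unfolding stab_def by auto

lemma stab_mem: "p \<in> stab J \<Longrightarrow> j \<in> J \<Longrightarrow> p j \<in> J" unfolding stab_def by auto

lemma subgroup_stab: "subgroup (stab J) perm_grp"
  by (rule perm.subgroupI) (auto simp: stab_comp stab_pinv stab_bij intro: stab_id)

text \<open>If \<open>g z\<close> left \<open>A\<close>, it would be fixed by \<open>g\<close>, and
  injectivity would give \<open>g z = z\<close>.\<close>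

lemma fixoff_stab:
  assumes "bij g" "\<And>z. z \<notin> A \<Longrightarrow> g z = z"
  shows "g \<in> stab A"
proof -
  have "g z \<in> A" if "z \<in> A" for z
    using assms that by (metis pinv_simps(1))
  moreover have "z \<in> g ` A" if "z \<in> A" for z
    using assms that by (metis imageI pinv_simps(2))
  ultimately show ?thesis using assms(1) unfolding stab_def by blast
qed

text \<open>If the images of the maps \<open>e j\<close> on \<open>D\<close> are disjoint copies of \<open>D\<close>, indexed by \<open>J\<close>,
  a permutation of \<open>J\<close> permutes these copies.\<close>

definition act :: "'j set \<Rightarrow> 'y set \<Rightarrow> ('j \<Rightarrow> 'y \<Rightarrow> 'x) \<Rightarrow> ('j \<Rightarrow> 'j) \<Rightarrow> 'x \<Rightarrow> 'x" where
  "act J D e p z = (if z \<in> (\<lambda>(j, y). e j y) ` (J \<times> D)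
     then (case inv_into (J \<times> D) (\<lambda>(j, y). e j y) z of (j, y) \<Rightarrow> e (p j) y) else z)"

locale copies =
  fixes J :: "'j set" and D :: "'y set" and e :: "'j \<Rightarrow> 'y \<Rightarrow> 'x"
  assumes inj: "inj_on (\<lambda>(j, y). e j y) (J \<times> D)"
begin

lemma act_in: "j \<in> J \<Longrightarrow> y \<in> D \<Longrightarrow> act J D e p (e j y) = e (p j) y"
  using inv_into_f_f[OF inj, of "(j, y)"] unfolding act_def by force

lemma act_out: "(\<And>j y. j \<in> J \<Longrightarrow> y \<in> D \<Longrightarrow> z \<noteq> e j y) \<Longrightarrow> act J D e p z = z"
  unfolding act_def by auto

lemma copies_cases:
  obtains j y where "j \<in> J" "y \<in> D" "z = e j y" | "\<And>j y. j \<in> J \<Longrightarrow> y \<in> D \<Longrightarrow> z \<noteq> e j y"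
  by blast

lemma act_comp: "p' \<in> stab J \<Longrightarrow> act J D e (p \<circ> p') = act J D e p \<circ> act J D e p'"
proof
  fix z assume "p' \<in> stab J"
  then show "act J D e (p \<circ> p') z = (act J D e p \<circ> act J D e p') z"
    by (cases z rule: copies_cases) (auto simp: act_in act_out stab_mem)
qed

lemma act_id: "act J D e id = id"
proof
  fix z show "act J D e id z = id z"
    by (cases z rule: copies_cases) (auto simp: act_in act_out)
qed

lemma act_cong: "(\<And>j. j \<in> J \<Longrightarrow> p j = p' j) \<Longrightarrow> act J D e p = act J D e p'"
proof
  fix z assume "\<And>j. j \<in> J \<Longrightarrow> p j = p' j"
  then show "act J D e p z = act J D e p' z"
    by (cases z rule: copies_cases) (auto simp: act_in act_out)
qed

lemma bij_act:
  assumes "p \<in> stab J"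
  shows "bij (act J D e p)"
proof (rule o_bij[of "act J D e (pinv p)"])
  show "act J D e (pinv p) \<circ> act J D e p = id" "act J D e p \<circ> act J D e (pinv p) = id"
    using assms by (auto simp: act_comp[symmetric] stab_pinv stab_bij act_id)
qed

lemma pinv_act: "p \<in> stab J \<Longrightarrow> pinv (act J D e p) = act J D e (pinv p)"
  by (rule pinv_eqI) (auto simp: bij_act act_comp[symmetric] stab_pinv stab_bij act_id)

end

section \<open>Three-cycles\<close>

definition cyc3 :: "nat \<Rightarrow> nat \<Rightarrow> nat \<Rightarrow> nat \<Rightarrow> nat" where
  "cyc3 a b c j = (if j = a then b else if j = b then c else if j = c then a else j)"

text \<open>Five points leave two spare ones beside each cycle, which is what writing it as a
  commutator of three-cycles takes.\<close>

definition three_cyc :: "(nat \<Rightarrow> nat) set" where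
  "three_cyc = {cyc3 a b c | a b c. distinct [a, b, c] \<and> {a, b, c} \<subseteq> {..<5}}"

lemma bij_cyc3: "distinct [a, b, c] \<Longrightarrow> bij (cyc3 a b c)"
  by (rule o_bij[of "cyc3 a c b"]) (auto simp: fun_eq_iff cyc3_def)

lemma cyc3_stab:
  assumes "distinct [a, b, c]" "{a, b, c} \<subseteq> J"
  shows "cyc3 a b c \<in> stab J"
  by (rule fixoff_stab) (use assms in \<open>auto simp: bij_cyc3 cyc3_def\<close>)

lemma three_cyc_stab: "p \<in> three_cyc \<Longrightarrow> p \<in> stab {..<5}"
  unfolding three_cyc_def using cyc3_stab by blast

lemma finite_three_cyc: "finite three_cyc"
proof -
  have "three_cyc \<subseteq> (\<lambda>(a, b, c). cyc3 a b c) ` ({..<5} \<times> {..<5} \<times> {..<5})"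
    unfolding three_cyc_def by force
  then show ?thesis by (rule finite_subset) auto
qed

lemma cyc3_mem: "distinct [a, b, c] \<Longrightarrow> {a, b, c} \<subseteq> {..<5} \<Longrightarrow> cyc3 a b c \<in> three_cyc"
  unfolding three_cyc_def by blast

lemma pinv_cyc3: "distinct [a, b, c] \<Longrightarrow> pinv (cyc3 a b c) = cyc3 a c b"
  by (rule pinv_eqI) (auto simp: bij_cyc3 fun_eq_iff cyc3_def)

definition comm :: "('x \<Rightarrow> 'x) \<Rightarrow> ('x \<Rightarrow> 'x) \<Rightarrow> 'x \<Rightarrow> 'x" where
  "comm f g = f \<circ> g \<circ> pinv f \<circ> pinv g"

text \<open>With \<open>d\<close> and \<open>e\<close> the two remaining points, the cycle (a b c)
  is the commutator of (a b d) and (a c e).\<close>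

lemma three_cyc_comm:
  assumes "p \<in> three_cyc"
  obtains p1 p2 where "p1 \<in> three_cyc" "p2 \<in> three_cyc" "p1 \<noteq> p2" "p = comm p1 p2"
proof -
  obtain a b c where abc: "distinct [a, b, c]" "{a, b, c} \<subseteq> {..<5}" "p = cyc3 a b c"
    using assms unfolding three_cyc_def by blast
  have "card ({..<5} - {a, b, c}) = 2" using abc by (subst card_Diff_subset) auto
  then obtain d e where de: "{..<5} - {a, b, c} = {d, e}" "d \<noteq> e" by (auto simp: card_2_iff)
  then have d: "distinct [a, b, d]" "distinct [a, c, e]" "{a, b, d} \<subseteq> {..<5}" "{a, c, e} \<subseteq> {..<5}"
    and ne: "b \<noteq> e" "d \<noteq> c"
    using abc by auto
  have "p = comm (cyc3 a b d) (cyc3 a c e)"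
    using d ne de(2) abc(1,3) unfolding comm_def
    by (auto simp: pinv_cyc3 fun_eq_iff cyc3_def)
  moreover have "cyc3 a b d \<noteq> cyc3 a c e"
  proof
    assume "cyc3 a b d = cyc3 a c e"
    then have "cyc3 a b d a = cyc3 a c e a" by simp
    then show False using d abc(1) by (simp add: cyc3_def)
  qed
  ultimately show ?thesis using that cyc3_mem d by blast
qed

lemma (in copies) act_comm:
  assumes "p \<in> stab J" "q \<in> stab J"
  shows "act J D e (comm p q) = comm (act J D e p) (act J D e q)"
  using assms unfolding comm_def by (simp add: act_comp stab_comp stab_pinv pinv_act)

section \<open>Permutations of a self-similar set\<close>

text \<open>\<open>W\<close> plays the role of a set of infinite words over the alphabet \<open>\<Omega> \<times> {..<n}\<close>, and \<open>d\<close> is a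
  pseudometric for which every generator defined below has bounded displacement. The lower bound on \<open>n\<close>
  leaves room for the sparse translates in the two-generator argument.\<close>

locale tower =
  fixes \<Omega> :: "'o set" and base :: 'o and Q :: "('o \<Rightarrow> 'o) set" and n :: nat
    and W :: "'x set" and cons :: "'o \<times> nat \<Rightarrow> 'x \<Rightarrow> 'x" and d :: "'x \<Rightarrow> 'x \<Rightarrow> nat"
  assumes base: "base \<in> \<Omega>"
    and finite_Q: "finite Q" and Q_stab: "Q \<subseteq> stab \<Omega>"
    and transitive: "\<And>\<omega>. \<omega> \<in> \<Omega> \<Longrightarrow> \<exists>q\<in>generate perm_grp Q. q base = \<omega>"
    and cons_inj: "inj_on (\<lambda>(b, w). cons b w) ((\<Omega> \<times> {..<n}) \<times> W)"
    and cons_image: "(\<lambda>(b, w). cons b w) ` ((\<Omega> \<times> {..<n}) \<times> W) = W"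
    and W_nonempty: "W \<noteq> {}"
    and n_odd: "odd n" and n_large: "18 * 2 ^ ((card Q + 3) * card three_cyc) + 9 \<le> n"
    and d_refl: "z \<in> W \<Longrightarrow> d z z = 0"
    and d_sym: "z \<in> W \<Longrightarrow> z' \<in> W \<Longrightarrow> d z z' = d z' z"
    and d_tri: "z \<in> W \<Longrightarrow> z' \<in> W \<Longrightarrow> z'' \<in> W \<Longrightarrow> d z z'' \<le> d z z' + d z' z''"
    and d_letter: "q \<in> Q \<Longrightarrow> \<exists>C. \<forall>\<omega>\<in>\<Omega>. \<forall>i<n. \<forall>w\<in>W. d (cons (\<omega>, i) w) (cons (q \<omega>, i) w) \<le> C"
    and d_class: "\<exists>C. \<forall>\<omega>\<in>\<Omega>. \<forall>i<n. \<forall>j<n. \<forall>w\<in>W. d (cons (\<omega>, i) w) (cons (\<omega>, j) w) \<le> C"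
    and d_base: "\<exists>C. \<forall>i<n. \<forall>w\<in>W. d w (cons (base, i) w) \<le> C"
begin

abbreviation B :: "('o \<times> nat) set" where "B \<equiv> \<Omega> \<times> {..<n}"

abbreviation pre :: "('o \<times> nat) list \<Rightarrow> 'x \<Rightarrow> 'x" where "pre \<equiv> foldr cons"

sublocale letters: copies B W cons
  by unfold_locales (rule cons_inj)

lemma n_ge: "n \<ge> 27"
proof -
  have "(1::nat) \<le> 2 ^ ((card Q + 3) * card three_cyc)" by simp
  then show ?thesis using n_large by linarith
qed

lemma cons_W [simp]: "b \<in> B \<Longrightarrow> w \<in> W \<Longrightarrow> cons b w \<in> W"
  using imageI[of "(b, w)" "B \<times> W" "\<lambda>(b, w). cons b w"] unfolding cons_image by simp

lemma cons_eq [simp]: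
  "b \<in> B \<Longrightarrow> w \<in> W \<Longrightarrow> b' \<in> B \<Longrightarrow> w' \<in> W \<Longrightarrow> cons b w = cons b' w' \<longleftrightarrow> b = b' \<and> w = w'"
  using inj_on_eq_iff[OF cons_inj, of "(b, w)" "(b', w')"] by (simp add: mem_Times_iff)

lemma W_cases:
  assumes "z \<in> W"
  obtains \<omega> i w where "\<omega> \<in> \<Omega>" "i < n" "w \<in> W" "z = cons (\<omega>, i) w"
proof -
  have "z \<in> (\<lambda>(b, w). cons b w) ` (B \<times> W)" using assms by (simp add: cons_image)
  then show thesis using that by auto
qed

lemma pre_W [simp]: "set u \<subseteq> B \<Longrightarrow> w \<in> W \<Longrightarrow> pre u w \<in> W"
  by (induction u) auto

text \<open>Distinct letters have disjoint images, so the two words agree letter by letter until one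
  of them runs out; what is left of the longer one is \<open>t\<close>.\<close>

lemma pre_comparable:
  assumes "set u \<subseteq> B" "set v \<subseteq> B" "w \<in> W" "w' \<in> W" "pre u w = pre v w'"
  shows "(\<exists>t. v = u @ t \<and> w = pre t w') \<or> (\<exists>t. u = v @ t \<and> w' = pre t w)"
  using assms
proof (induction u arbitrary: v)
  case (Cons b u)
  show ?case
  proof (cases v)
    case (Cons c v')
    with Cons.prems have "b = c" "pre u w = pre v' w'" by auto
    with Cons.IH[of v'] Cons.prems Cons show ?thesis by auto
  qed (use Cons.prems in auto)
qed auto

subsection \<open>Permutations of the first letter\<close>

definition lift :: "('o \<times> nat \<Rightarrow> 'o \<times> nat) \<Rightarrow> 'x \<Rightarrow> 'x" where
  "lift p = act B W cons p"

lemma lift_cons [simp]: "\<omega> \<in> \<Omega> \<Longrightarrow> i < n \<Longrightarrow> w \<in> W \<Longrightarrow> lift p (cons (\<omega>, i) w) = cons (p (\<omega>, i)) w"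
  unfolding lift_def by (rule letters.act_in) auto

lemma lift_out: "z \<notin> W \<Longrightarrow> lift p z = z"
  unfolding lift_def by (rule letters.act_out) auto

lemma lift_comp: "p' \<in> stab B \<Longrightarrow> lift (p \<circ> p') = lift p \<circ> lift p'"
  unfolding lift_def by (rule letters.act_comp)

lemma lift_cong: "(\<And>\<omega> i. \<omega> \<in> \<Omega> \<Longrightarrow> i < n \<Longrightarrow> p (\<omega>, i) = p' (\<omega>, i)) \<Longrightarrow> lift p = lift p'"
  unfolding lift_def by (rule letters.act_cong) auto

lemma bij_lift: "p \<in> stab B \<Longrightarrow> bij (lift p)"
  unfolding lift_def by (rule letters.bij_act)

lemma pinv_lift: "p \<in> stab B \<Longrightarrow> pinv (lift p) = lift (pinv p)"
  unfolding lift_def by (rule letters.pinv_act)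

lemma lift_id: "lift id = id"
  unfolding lift_def by (rule letters.act_id)

definition at_class :: "('o \<Rightarrow> 'o) \<Rightarrow> nat \<Rightarrow> 'o \<times> nat \<Rightarrow> 'o \<times> nat" where
  "at_class q i = (\<lambda>(\<omega>, j). (if j = i then q \<omega> else \<omega>, j))"

definition on_class :: "(nat \<Rightarrow> nat) \<Rightarrow> 'o \<times> nat \<Rightarrow> 'o \<times> nat" where
  "on_class p = (\<lambda>(\<omega>, j). (\<omega>, p j))"

lemma at_class_simp [simp]: "at_class q i (\<omega>, j) = (if j = i then q \<omega> else \<omega>, j)"
  unfolding at_class_def by simp

lemma on_class_simp [simp]: "on_class p (\<omega>, j) = (\<omega>, p j)"
  unfolding on_class_def by simp

lemma at_class_comp: "at_class (q \<circ> r) i = at_class q i \<circ> at_class r i"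
  by (auto simp: fun_eq_iff at_class_def)

lemma on_class_comp: "on_class (p \<circ> p') = on_class p \<circ> on_class p'"
  by (auto simp: fun_eq_iff)

lemma bij_at_class: "bij q \<Longrightarrow> bij (at_class q i)"
  by (rule o_bij[of "at_class (pinv q) i"]) (auto simp: fun_eq_iff)

lemma bij_on_class: "bij p \<Longrightarrow> bij (on_class p)"
  by (rule o_bij[of "on_class (pinv p)"]) (auto simp: fun_eq_iff)

lemma pinv_at_class: "bij q \<Longrightarrow> pinv (at_class q i) = at_class (pinv q) i"
  by (rule pinv_eqI) (auto simp: fun_eq_iff bij_at_class)

lemma pinv_on_class: "bij p \<Longrightarrow> pinv (on_class p) = on_class (pinv p)"
  by (rule pinv_eqI) (auto simp: fun_eq_iff bij_on_class)

lemma stabI: "bij p \<Longrightarrow> (\<And>j. j \<in> J \<Longrightarrow> p j \<in> J) \<Longrightarrow> (\<And>j. j \<in> J \<Longrightarrow> pinv p j \<in> J) \<Longrightarrow> p \<in> stab J"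
  unfolding stab_def by (auto simp: image_iff) (metis pinv_simps(2))

lemma at_class_stab: "q \<in> stab \<Omega> \<Longrightarrow> at_class q i \<in> stab B"
  by (rule stabI) (auto simp: bij_at_class stab_bij pinv_at_class stab_mem stab_pinv)

lemma on_class_stab: "p \<in> stab {..<n} \<Longrightarrow> on_class p \<in> stab B"
  using stab_mem[of p "{..<n}"] stab_mem[OF stab_pinv, of p "{..<n}"]
  by (intro stabI) (auto simp: bij_on_class stab_bij pinv_on_class)

text \<open>The integer argument makes \<open>rot (- k)\<close> the inverse rotation; numbers from
  \<open>n\<close> on stay fixed so that \<open>rot k\<close> is a bijection of all of
  \<open>nat\<close>.\<close>

definition rot :: "int \<Rightarrow> nat \<Rightarrow> nat" where
  "rot k j = (if j < n then nat ((int j + k) mod int n) else j)"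

lemma rot_less: "j < n \<Longrightarrow> rot k j < n"
  unfolding rot_def using n_ge by (auto simp: nat_less_iff)

lemma rot_rot: "rot k (rot l j) = rot (k + l) j"
  using rot_less[of j l] n_ge unfolding rot_def by (auto simp: mod_simps algebra_simps)

lemma rot_0: "rot 0 j = j"
  unfolding rot_def by simp

lemma rot_small: "0 \<le> int j + k \<Longrightarrow> int j + k < int n \<Longrightarrow> j < n \<Longrightarrow> rot k j = nat (int j + k)"
  unfolding rot_def by simp

lemma bij_rot: "bij (rot k)"
  by (rule o_bij[of "rot (-k)"]) (auto simp: fun_eq_iff rot_rot rot_0)

lemma rot_stab: "rot k \<in> stab {..<n}"
  by (rule fixoff_stab) (auto simp: bij_rot rot_def)

definition shift :: "int \<Rightarrow> 'x \<Rightarrow> 'x" where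
  "shift k = lift (on_class (rot k))"

lemma shift_cons [simp]: "\<omega> \<in> \<Omega> \<Longrightarrow> i < n \<Longrightarrow> w \<in> W \<Longrightarrow> shift k (cons (\<omega>, i) w) = cons (\<omega>, rot k i) w"
  unfolding shift_def by simp

lemma shift_add: "shift (k + l) = shift k \<circ> shift l"
  unfolding shift_def
  by (subst lift_comp[symmetric]) (auto intro!: lift_cong simp: on_class_stab rot_stab rot_rot)

lemma shift_0: "shift 0 = id"
proof -
  have "shift 0 = lift id" unfolding shift_def by (rule lift_cong) (simp add: rot_0)
  then show ?thesis by (simp add: lift_id)
qed

lemma bij_shift: "bij (shift k)"
  unfolding shift_def by (intro bij_lift on_class_stab rot_stab)

lemma pinv_shift: "pinv (shift k) = shift (- k)"
  by (rule pinv_eqI) (auto simp: bij_shift shift_0 simp flip: shift_add)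

lemma shift_W: "w \<in> W \<Longrightarrow> shift k w \<in> W"
  by (erule W_cases) (simp add: rot_less)

lemma shift_minus [simp]: "shift k (shift (- k) w) = w" "shift (- k) (shift k w) = w"
  using shift_add[of k "-k"] shift_add[of "-k" k] shift_0 by (auto simp: fun_eq_iff)

subsection \<open>The generators\<close>

definition cls :: "nat set \<Rightarrow> 'x set" where
  "cls I = {cons (\<omega>, i) w | \<omega> i w. \<omega> \<in> \<Omega> \<and> i < n \<and> i \<in> I \<and> w \<in> W}"

lemma cons_cls [simp]: "\<omega> \<in> \<Omega> \<Longrightarrow> i < n \<Longrightarrow> w \<in> W \<Longrightarrow> cons (\<omega>, i) w \<in> cls I \<longleftrightarrow> i \<in> I"
  unfolding cls_def by auto

lemma cls_subset: "cls I \<subseteq> W"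
  unfolding cls_def by auto

lemma cls_cases:
  assumes "z \<in> cls I"
  obtains \<omega> i w where "\<omega> \<in> \<Omega>" "i < n" "i \<in> I" "w \<in> W" "z = cons (\<omega>, i) w"
  using assms unfolding cls_def by blast

text \<open>Three families of copies: \<open>twist\<close> permutes classes of letters, conjugated by \<open>q\<close> on class \<open>0\<close>, and
  brings in the group acting on \<open>\<Omega>\<close>; \<open>dup\<close> relates cones of different depth; \<open>turn\<close> makes the shift
  available on second letters.\<close>

definition twist :: "('o \<Rightarrow> 'o) \<Rightarrow> (nat \<Rightarrow> nat) \<Rightarrow> 'x \<Rightarrow> 'x" where
  "twist q p = lift (at_class q 0 \<circ> on_class p \<circ> at_class (pinv q) 0)"

text \<open>Copy 0 is the set \<open>cls {..<5}\<close> itself, and each other copy is squeezed into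
  the cone of one letter. The offset 4 puts copies 1 to 4 into classes 5 to 8, away from copy
  0.\<close>

definition dup_copy :: "nat \<Rightarrow> 'x \<Rightarrow> 'x" where
  "dup_copy j = (if j = 0 then id else cons (base, 4 + j))"

definition dup :: "(nat \<Rightarrow> nat) \<Rightarrow> 'x \<Rightarrow> 'x" where
  "dup p = act {..<5} (cls {..<5}) dup_copy p"

text \<open>The shift is built into copy 0 alone, so moving points between copy 0 and another copy
  rotates the classes of their second letters.\<close>

definition turn_copy :: "nat \<Rightarrow> 'x \<Rightarrow> 'x" where
  "turn_copy j w = cons (base, j) (if j = 0 then shift 1 w else w)"

definition turn :: "(nat \<Rightarrow> nat) \<Rightarrow> 'x \<Rightarrow> 'x" where
  "turn p = act {..<5} W turn_copy p"

definition E :: "('x \<Rightarrow> 'x) set" where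
  "E = (\<lambda>(q, p). twist q p) ` (insert id Q \<times> three_cyc) \<union> dup ` three_cyc \<union> turn ` three_cyc"

sublocale dups: copies "{..<5}" "cls {..<5}" dup_copy
proof
  show "inj_on (\<lambda>(j, y). dup_copy j y) ({..<5} \<times> cls {..<5})"
    using n_ge base by (auto simp: inj_on_def dup_copy_def elim!: cls_cases split: if_splits)
qed

sublocale turns: copies "{..<5}" W turn_copy
proof
  have "bij (shift 1)" by (rule bij_shift)
  then show "inj_on (\<lambda>(j, y). turn_copy j y) ({..<5} \<times> W)"
    using n_ge base shift_W
    by (auto simp: inj_on_def turn_copy_def split: if_splits) (metis shift_minus(2))
qed

lemma small_stab: "p \<in> stab {..<5} \<Longrightarrow> (\<And>j. j \<ge> 5 \<Longrightarrow> p j = j) \<Longrightarrow> p \<in> stab {..<n}"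
  using stab_bij by (rule fixoff_stab) (use n_ge in auto)

lemma three_cyc_big [simp]: "p \<in> three_cyc \<Longrightarrow> j \<ge> 5 \<Longrightarrow> p j = j"
  unfolding three_cyc_def by (auto simp: cyc3_def)

lemma three_cyc_stab_n: "p \<in> three_cyc \<Longrightarrow> p \<in> stab {..<n}"
  by (simp add: small_stab three_cyc_stab)

lemma Q_id_stab: "q \<in> insert id Q \<Longrightarrow> q \<in> stab \<Omega>"
  using Q_stab by auto

lemma twist_inner_stab:
  "q \<in> stab \<Omega> \<Longrightarrow> p \<in> stab {..<n} \<Longrightarrow> at_class q 0 \<circ> on_class p \<circ> at_class (pinv q) 0 \<in> stab B"
  by (intro stab_comp at_class_stab on_class_stab stab_pinv)

lemma twist_conj:
  assumes "q \<in> stab \<Omega>" "p \<in> stab {..<n}"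
  shows "twist q p = lift (at_class q 0) \<circ> lift (on_class p) \<circ> pinv (lift (at_class q 0))"
  using assms unfolding twist_def
  by (simp add: lift_comp at_class_stab on_class_stab stab_comp stab_pinv pinv_lift pinv_at_class stab_bij)

lemma bij_twist: "q \<in> stab \<Omega> \<Longrightarrow> p \<in> stab {..<n} \<Longrightarrow> bij (twist q p)"
  unfolding twist_def by (intro bij_lift twist_inner_stab)

lemma twist_comp:
  assumes "q \<in> stab \<Omega>" "p \<in> stab {..<n}" "p' \<in> stab {..<n}"
  shows "twist q (p \<circ> p') = twist q p \<circ> twist q p'"
proof -
  have "bij q" using assms stab_bij by auto
  then show ?thesis
  unfolding twist_def using assms
  by (subst lift_comp[symmetric]) (auto intro!: lift_cong simp: twist_inner_stab)
qed

lemma pinv_twist: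
  assumes "q \<in> stab \<Omega>" "p \<in> stab {..<n}"
  shows "pinv (twist q p) = twist q (pinv p)"
proof (rule pinv_eqI)
  have "bij q" "bij p" using assms stab_bij by auto
  then have "twist q id = id"
    unfolding twist_def by (subst lift_id[symmetric]) (auto intro!: lift_cong)
  then show "twist q p \<circ> twist q (pinv p) = id"
    using assms by (simp add: twist_comp[symmetric] stab_pinv stab_bij)
qed (use assms bij_twist in auto)

lemma twist_comm:
  assumes "q \<in> stab \<Omega>" "p \<in> stab {..<n}" "p' \<in> stab {..<n}"
  shows "twist q (comm p p') = comm (twist q p) (twist q p')"
  using assms unfolding comm_def by (simp add: twist_comp stab_comp stab_pinv pinv_twist)

text \<open>Each family in \<open>E\<close> consists of the values of a homomorphism at
  three-cycles, so \<open>three_cyc_comm\<close> carries over. Generation by two elements and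
  simplicity both rest on this.\<close>

lemma E_comm:
  assumes "g \<in> E"
  obtains g1 g2 where "g1 \<in> E" "g2 \<in> E" "g = comm g1 g2"
proof -
  consider q p where "q \<in> insert id Q" "p \<in> three_cyc" "g = twist q p"
    | p where "p \<in> three_cyc" "g = dup p" | p where "p \<in> three_cyc" "g = turn p"
    using assms unfolding E_def by auto
  then show ?thesis
  proof cases
    case 1
    obtain p1 p2 where p: "p1 \<in> three_cyc" "p2 \<in> three_cyc" "p = comm p1 p2"
      using three_cyc_comm[OF 1(2)] .
    show ?thesis
      by (rule that[of "twist q p1" "twist q p2"])
        (use 1 p in \<open>auto simp: E_def Q_id_stab twist_comm three_cyc_stab_n\<close>)
  next
    case 2
    obtain p1 p2 where p: "p1 \<in> three_cyc" "p2 \<in> three_cyc" "p = comm p1 p2"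
      using three_cyc_comm[OF 2(1)] .
    show ?thesis
      by (rule that[of "dup p1" "dup p2"])
        (use 2 p in \<open>auto simp: E_def dup_def dups.act_comm three_cyc_stab\<close>)
  next
    case 3
    obtain p1 p2 where p: "p1 \<in> three_cyc" "p2 \<in> three_cyc" "p = comm p1 p2"
      using three_cyc_comm[OF 3(1)] .
    show ?thesis
      by (rule that[of "turn p1" "turn p2"])
        (use 3 p in \<open>auto simp: E_def turn_def turns.act_comm three_cyc_stab\<close>)
  qed
qed

lemma finite_E: "finite E"
  unfolding E_def using finite_Q finite_three_cyc by auto

text \<open>The bound is the exponent in \<open>n_large\<close>: that many sparse translates have to
  fit into the \<open>n\<close> classes.\<close>

lemma card_E: "card E \<le> (card Q + 3) * card three_cyc"
proof -
  let ?T = "(\<lambda>(q, p). twist q p) ` (insert id Q \<times> three_cyc)"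
  have fin: "finite (insert id Q \<times> three_cyc)" using finite_Q finite_three_cyc by simp
  have "card ?T \<le> card (insert id Q \<times> three_cyc)" by (rule card_image_le[OF fin])
  also have "\<dots> \<le> (card Q + 1) * card three_cyc"
    using finite_Q by (simp add: card_cartesian_product card_insert_if)
  finally have T: "card ?T \<le> (card Q + 1) * card three_cyc" .
  have "card E \<le> card ?T + card (dup ` three_cyc) + card (turn ` three_cyc)"
    unfolding E_def by (meson add_le_mono card_Un_le le_trans order_refl)
  with T card_image_le[OF finite_three_cyc, of dup] card_image_le[OF finite_three_cyc, of turn]
  show ?thesis by (simp add: algebra_simps)
qed

lemma dup_copy_cls: "j < 5 \<Longrightarrow> y \<in> cls {..<5} \<Longrightarrow> dup_copy j y \<in> cls {..<9}"
  using base n_ge cls_subset[of "{..<5}"] by (auto simp: dup_copy_def elim!: cls_cases)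

lemma turn_copy_cls: "j < 5 \<Longrightarrow> y \<in> W \<Longrightarrow> turn_copy j y \<in> cls {..<9}"
  using base n_ge shift_W[of y 1] by (auto simp: turn_copy_def)

lemma dup_fix: "z \<notin> cls {..<9} \<Longrightarrow> dup p z = z"
  unfolding dup_def by (rule dups.act_out) (use dup_copy_cls in auto)

lemma turn_fix: "z \<notin> cls {..<9} \<Longrightarrow> turn p z = z"
  unfolding turn_def by (rule turns.act_out) (use turn_copy_cls in auto)

lemma twist_fix: "p \<in> three_cyc \<Longrightarrow> z \<notin> cls {..<9} \<Longrightarrow> twist q p z = z"
proof (cases "z \<in> W")
  case True
  assume p: "p \<in> three_cyc" and z: "z \<notin> cls {..<9}"
  from True show ?thesis by (rule W_cases) (use p z in \<open>simp add: twist_def\<close>)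
qed (simp add: twist_def lift_out)

text \<open>Nine classes suffice as a common support: the copies for \<open>dup\<close> lie in
  classes 0 to 8, while \<open>turn\<close> and \<open>twist\<close> only move classes 0 to
  4.\<close>

lemma E_fix: "g \<in> E \<Longrightarrow> z \<notin> cls {..<9} \<Longrightarrow> g z = z"
  unfolding E_def by (auto simp: dup_fix turn_fix twist_fix)

lemma bij_E: "g \<in> E \<Longrightarrow> bij g"
  unfolding E_def dup_def turn_def
  by (auto simp: three_cyc_stab dups.bij_act turns.bij_act bij_twist three_cyc_stab_n Q_id_stab)

lemma E_stab: "g \<in> E \<Longrightarrow> g \<in> stab (cls {..<9})"
  by (rule fixoff_stab) (auto simp: bij_E E_fix)

end

section \<open>Commutators of maps with nearly disjoint supports, and generated permutation
  groups\<close>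

text \<open>On \<open>A\<close> the two pairs agree and preserve \<open>A\<close>. Off
  \<open>A\<close> the maps \<open>g\<close> and \<open>h\<close> only move points of the disjoint
  sets \<open>M\<close> and \<open>M'\<close>, hence commute there.\<close>

lemma comm_eq_of_disjoint_supports:
  assumes bij: "bij g" "bij h" "bij s" "bij t"
    and eq: "\<And>z. z \<in> A \<Longrightarrow> g z = s z" "\<And>z. z \<in> A \<Longrightarrow> h z = t z"
    and st: "\<And>z. z \<notin> A \<Longrightarrow> s z = z" "\<And>z. z \<notin> A \<Longrightarrow> t z = z"
    and inv: "\<And>z. z \<in> M \<Longrightarrow> g z \<in> M" "\<And>z. z \<in> M' \<Longrightarrow> h z \<in> M'"
    and fix': "\<And>z. z \<notin> A \<Longrightarrow> z \<notin> M \<Longrightarrow> g z = z" "\<And>z. z \<notin> A \<Longrightarrow> z \<notin> M' \<Longrightarrow> h z = z"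
    and disj: "A \<inter> M = {}" "A \<inter> M' = {}" "M \<inter> M' = {}"
  shows "comm g h = comm s t"
proof -
  have sA: "s \<in> stab A" and tA: "t \<in> stab A" using fixoff_stab bij st by blast+
  have sinv: "pinv s z = z" and tinv: "pinv t z = z" if "z \<notin> A" for z
    using st that bij by (metis pinv_simps(1))+
  have c: "comm s t z = z" if "z \<notin> A" for z
    using that st sinv tinv unfolding comm_def by simp
  \<comment> \<open>Clearing the inverses of \<open>g\<close> and \<open>h\<close> from the claim
    lets it be checked region by region.\<close>
  have "g (h z) = comm s t (h (g z))" for z
  proof -
    consider "z \<in> A" | "z \<in> M" | "z \<in> M'" | "z \<notin> A" "z \<notin> M" "z \<notin> M'" by blast
    then show ?thesis
    proof cases
      case 1
      then show ?thesis
        using stab_mem[OF sA] stab_mem[OF tA] bij by (simp add: eq comm_def)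
    next
      case 2
      then have "z \<notin> A" "z \<notin> M'" "g z \<in> M" "g z \<notin> A" "g z \<notin> M'" using inv disj by blast+
      then show ?thesis using fix' c by simp
    next
      case 3
      then have "z \<notin> A" "z \<notin> M" "h z \<in> M'" "h z \<notin> A" "h z \<notin> M" using inv disj by blast+
      then show ?thesis using fix' c by simp
    qed (use fix' c in simp)
  qed
  then have "g \<circ> h = comm s t \<circ> h \<circ> g" by (simp add: fun_eq_iff)
  then have "g \<circ> h \<circ> pinv g \<circ> pinv h = comm s t \<circ> h \<circ> (g \<circ> pinv g) \<circ> pinv h"
    by (simp add: comp_assoc)
  also have "\<dots> = comm s t \<circ> (h \<circ> pinv h)" using bij by (simp add: comp_assoc)
  finally show ?thesis using bij unfolding comm_def by simp
qed

lemma gen_comp: "f \<in> generate perm_grp S \<Longrightarrow> g \<in> generate perm_grp S \<Longrightarrow> f \<circ> g \<in> generate perm_grp S"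
  using generate.eng[of f perm_grp S g] by simp

lemma gen_id: "id \<in> generate perm_grp S"
  using generate.one[of perm_grp S] by simp

lemma gen_incl: "f \<in> S \<Longrightarrow> f \<in> generate perm_grp S"
  by (rule generate.incl)

lemma gen_bij: "S \<subseteq> {f. bij f} \<Longrightarrow> f \<in> generate perm_grp S \<Longrightarrow> bij f"
  using perm.generate_in_carrier[of S f] by simp

lemma gen_pinv: "S \<subseteq> {f. bij f} \<Longrightarrow> f \<in> generate perm_grp S \<Longrightarrow> pinv f \<in> generate perm_grp S"
  using perm.generate_m_inv_closed[of S f] gen_bij[of S f] by simp

lemma gen_comm:
  "S \<subseteq> {f. bij f} \<Longrightarrow> f \<in> generate perm_grp S \<Longrightarrow> g \<in> generate perm_grp S \<Longrightarrow> comm f g \<in> generate perm_grp S"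
  unfolding comm_def by (intro gen_comp gen_pinv)

lemma gen_least: "subgroup U perm_grp \<Longrightarrow> S \<subseteq> U \<Longrightarrow> generate perm_grp S \<subseteq> U"
  by (rule perm.generate_subgroup_incl)

text \<open>With both sums ordered, a larger top exponent on one side would make that side larger;
  so the top exponents agree, and then the others do.\<close>

lemma two_power_Sidon:
  fixes a b c d :: nat
  assumes "(2::nat) ^ a + 2 ^ b = 2 ^ c + 2 ^ d"
  shows "a = c \<or> a = d"
proof -
  have *: "a = c \<and> b = d" if "a \<le> b" "c \<le> d" and eq: "(2::nat) ^ a + 2 ^ b = 2 ^ c + 2 ^ d" for a b c d
  proof -
    have "\<not> b < d" if "a \<le> b" "(2::nat) ^ a + 2 ^ b = 2 ^ c + 2 ^ d" for a b c d :: nat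
    proof
      assume "b < d"
      have "(2::nat) ^ a + 2 ^ b \<le> 2 ^ Suc b" using that(1) by simp
      also have "\<dots> \<le> 2 ^ d" using \<open>b < d\<close> by (intro power_increasing) auto
      also have "\<dots> < 2 ^ c + 2 ^ d" by simp
      finally show False using that(2) by simp
    qed
    from this[of a b c d] this[of c d a b] that have "b = d" by simp
    with eq show ?thesis by simp
  qed
  consider "a \<le> b" "c \<le> d" | "a \<le> b" "d \<le> c" | "b \<le> a" "c \<le> d" | "b \<le> a" "d \<le> c" by linarith
  then show ?thesis
    using *[of a b c d] *[of a b d c] *[of b a c d] *[of b a d c] assms by cases (auto simp: add.commute)
qed

context tower begin

definition \<Gamma> :: "('x \<Rightarrow> 'x) set" where
  "\<Gamma> = generate perm_grp (insert (shift 1) E)"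

lemma gens_bij: "insert (shift 1) E \<subseteq> {f. bij f}"
  using bij_shift bij_E by auto

lemmas \<Gamma>_comp = gen_comp[where S = "insert (shift 1) E", folded \<Gamma>_def]
  and \<Gamma>_id = gen_id[where S = "insert (shift 1) E", folded \<Gamma>_def]
  and \<Gamma>_bij = gen_bij[OF gens_bij, folded \<Gamma>_def]
  and \<Gamma>_pinv = gen_pinv[OF gens_bij, folded \<Gamma>_def]
  and \<Gamma>_comm = gen_comm[OF gens_bij, folded \<Gamma>_def]
  and \<Gamma>_least = gen_least[where S = "insert (shift 1) E", folded \<Gamma>_def]

lemma subgroup_\<Gamma>: "subgroup \<Gamma> perm_grp"
  unfolding \<Gamma>_def by (rule perm.generate_is_subgroup) (use gens_bij in simp)

lemma E_\<Gamma>: "g \<in> E \<Longrightarrow> g \<in> \<Gamma>"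
  unfolding \<Gamma>_def by (rule gen_incl) simp

lemma shift_gen:
  assumes "S \<subseteq> {f. bij f}" "shift 1 \<in> generate perm_grp S"
  shows "shift k \<in> generate perm_grp S"
proof -
  have nat: "shift (int m) \<in> generate perm_grp S" for m
  proof (induction m)
    case 0 show ?case unfolding of_nat_0 shift_0 by (rule gen_id)
  next
    case (Suc m)
    have "shift (int (Suc m)) = shift 1 \<circ> shift (int m)" by (simp flip: shift_add)
    then show ?case using gen_comp[OF assms(2) Suc] by (simp only:)
  qed
  show ?thesis
  proof (cases "k \<ge> 0")
    case True
    then show ?thesis using nat[of "nat k"] by simp
  next
    case False
    then have "shift k = pinv (shift (int (nat (- k))))" by (simp add: pinv_shift)
    then show ?thesis using gen_pinv[OF assms(1) nat] by (simp only:)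
  qed
qed

lemma shift_\<Gamma>: "shift k \<in> \<Gamma>"
  unfolding \<Gamma>_def by (rule shift_gen[OF gens_bij]) (simp add: gen_incl)

subsection \<open>Two generators\<close>

text \<open>Room for one translate of the common support \<open>cls {..<9}\<close> of the elements
  of \<open>E\<close>.\<close>

definition slot :: "nat \<Rightarrow> 'x set" where
  "slot l = cls {9 * 2 ^ l..<9 * 2 ^ l + 9}"

abbreviation offset :: "nat \<Rightarrow> int" where
  "offset l \<equiv> 9 * 2 ^ l"

text \<open>Amalgamates the list into one permutation by moving entry \<open>m\<close> to slot
  \<open>m\<close>; for a list of all of \<open>E\<close> this is the second generator beside the
  shift.\<close>

primrec amal :: "('x \<Rightarrow> 'x) list \<Rightarrow> nat \<Rightarrow> 'x \<Rightarrow> 'x" where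
  "amal es 0 = id"
| "amal es (Suc m) = shift (offset m) \<circ> es ! m \<circ> shift (- offset m) \<circ> amal es m"

context
  fixes es assumes es: "set es = E" "length es = card E"
begin

text \<open>The factor 18 is twice 9: a sum of two offsets together with a remainder below 9 stays
  below \<open>n\<close>. The integer version serves computations with \<open>rot\<close>.\<close>

lemma length_bound: "l < length es \<Longrightarrow> 18 * 2 ^ l + 9 \<le> n" "l < length es \<Longrightarrow> (18::int) * 2 ^ l + 9 \<le> int n"
proof -
  assume "l < length es"
  then have "l \<le> (card Q + 3) * card three_cyc" using card_E es by linarith
  then have "(2::nat) ^ l \<le> 2 ^ ((card Q + 3) * card three_cyc)" by (intro power_increasing) auto
  then show *: "18 * 2 ^ l + 9 \<le> n" using n_large by linarith
  have "int (18 * 2 ^ l + 9) \<le> int n" using * by (rule iffD2[OF zle_int])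
  then show "(18::int) * 2 ^ l + 9 \<le> int n" by simp
qed

lemma shift_mem_slot:
  assumes "l < length es" "z \<in> W"
  shows "shift (offset l) z \<in> slot l \<longleftrightarrow> z \<in> cls {..<9}"
proof -
  obtain \<omega> i w where z: "\<omega> \<in> \<Omega>" "i < n" "w \<in> W" "z = cons (\<omega>, i) w" using assms(2) by (rule W_cases)
  have "rot (offset l) i \<in> {9 * 2 ^ l..<9 * 2 ^ l + 9} \<longleftrightarrow> i < 9"
  proof
    assume "i < 9"
    then have "rot (offset l) i = i + 9 * 2 ^ l"
      using length_bound[OF assms(1)] z(2)
      by (subst rot_small) (auto simp: nat_add_distrib nat_mult_distrib nat_power_eq)
    then show "rot (offset l) i \<in> {9 * 2 ^ l..<9 * 2 ^ l + 9}" using \<open>i < 9\<close> by simp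
  next
    assume a: "rot (offset l) i \<in> {9 * 2 ^ l..<9 * 2 ^ l + 9}"
    then obtain r where r: "rot (offset l) i = 9 * 2 ^ l + r" "r < 9"
      by (metis atLeastLessThan_iff le_Suc_ex nat_add_left_cancel_less)
    have "rot (- offset l) (9 * 2 ^ l + r) = r"
      using length_bound[OF assms(1)] r(2)
      by (subst rot_small) auto
    moreover have "rot (- offset l) (rot (offset l) i) = i" by (simp add: rot_rot rot_0)
    ultimately show "i < 9" using r by simp
  qed
  then show ?thesis using z by (simp add: slot_def rot_less)
qed

text \<open>Dividing the number of the class by 9 recovers \<open>2 ^ l\<close>.\<close>

lemma slot_disjoint: "z \<in> slot l \<Longrightarrow> z \<in> slot l' \<Longrightarrow> l = l'"
proof -
  assume a: "z \<in> slot l" "z \<in> slot l'"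
  then obtain i :: nat where i: "9 * 2 ^ l \<le> i" "i < 9 * 2 ^ l + 9" "9 * 2 ^ l' \<le> i" "i < 9 * 2 ^ l' + 9"
    unfolding slot_def by (auto elim!: cls_cases)
  have "i div 9 = (2::nat) ^ l" "i div 9 = (2::nat) ^ l'" using i by (auto intro!: div_nat_eqI)
  then show "l = l'" by simp
qed

lemma slot_W: "slot l \<subseteq> W"
  unfolding slot_def by (rule cls_subset)

definition piece :: "nat \<Rightarrow> 'x \<Rightarrow> 'x" where
  "piece l = shift (offset l) \<circ> es ! l \<circ> shift (- offset l)"

lemma es_E: "l < length es \<Longrightarrow> es ! l \<in> E"
  using es nth_mem by blast

lemma piece_slot:
  assumes "l < length es" "z \<in> slot l"
  shows "piece l z \<in> slot l"
proof -
  let ?y = "shift (- offset l) z"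
  have y: "?y \<in> W" using slot_W assms shift_W by blast
  then have "?y \<in> cls {..<9}" using shift_mem_slot[OF assms(1) y] assms(2) by simp
  then have "(es ! l) ?y \<in> cls {..<9}" using stab_mem[OF E_stab[OF es_E[OF assms(1)]]] by blast
  then show ?thesis using shift_mem_slot[OF assms(1)] cls_subset unfolding piece_def by auto
qed

lemma shift_out: "z \<notin> W \<Longrightarrow> shift k z = z"
  unfolding shift_def by (rule lift_out)

lemma piece_fix:
  assumes "l < length es" "z \<notin> slot l"
  shows "piece l z = z"
proof -
  let ?y = "shift (- offset l) z"
  have "?y \<notin> cls {..<9}"
  proof
    assume y: "?y \<in> cls {..<9}"
    then have "shift (offset l) ?y \<in> slot l" using shift_mem_slot[OF assms(1)] cls_subset by blast
    then show False using assms(2) by simp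
  qed
  then show ?thesis using E_fix[OF es_E[OF assms(1)]] unfolding piece_def by simp
qed

lemma amal_Suc: "amal es (Suc m) z = piece m (amal es m z)"
  unfolding piece_def by simp

lemma amal_fix: "m \<le> length es \<Longrightarrow> (\<And>l. l < m \<Longrightarrow> z \<notin> slot l) \<Longrightarrow> amal es m z = z"
proof (induction m)
  case (Suc m)
  then show ?case unfolding amal_Suc by (simp add: piece_fix)
qed simp

text \<open>Slots are disjoint and each piece preserves its own slot, so of all the factors only
  piece \<open>l\<close> acts here.\<close>

lemma amal_slot: "m \<le> length es \<Longrightarrow> l < m \<Longrightarrow> z \<in> slot l \<Longrightarrow> amal es m z = piece l z"
proof (induction m)
  case (Suc m)
  show ?case
  proof (cases "l = m")
    case True
    then have "amal es m z = z" using Suc.prems slot_disjoint by (intro amal_fix) auto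
    then show ?thesis using True unfolding amal_Suc by simp
  next
    case False
    then have "amal es m z = piece l z" using Suc by simp
    moreover have "piece l z \<in> slot l" using Suc.prems by (intro piece_slot) auto
    then have "piece l z \<notin> slot m" using slot_disjoint False by blast
    ultimately show ?thesis unfolding amal_Suc using Suc.prems by (simp add: piece_fix)
  qed
qed simp

lemma amal_\<Gamma>: "m \<le> length es \<Longrightarrow> amal es m \<in> \<Gamma>"
proof (induction m)
  case 0 show ?case unfolding amal.simps by (rule \<Gamma>_id)
next
  case (Suc m)
  then have "es ! m \<in> \<Gamma>" "amal es m \<in> \<Gamma>" using E_\<Gamma>[OF es_E[of m]] by simp_all
  then show ?case unfolding amal.simps by (intro \<Gamma>_comp shift_\<Gamma>)
qed

text \<open>Conjugation by the shift brings slot \<open>i\<close> back to \<open>cls {..<9}\<close>,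
  where the result acts as entry \<open>i\<close> of the list.\<close>

definition window :: "nat \<Rightarrow> 'x \<Rightarrow> 'x" where
  "window i = shift (- offset i) \<circ> amal es (length es) \<circ> shift (offset i)"

text \<open>The translates of the other slots, the only place outside \<open>cls {..<9}\<close>
  where \<open>window i\<close> can move points.\<close>

definition rest :: "nat \<Rightarrow> 'x set" where
  "rest i = {z \<in> W. \<exists>l<length es. l \<noteq> i \<and> shift (offset i) z \<in> slot l}"

lemma bij_window: "bij (window i)"
  unfolding window_def using amal_\<Gamma> by (intro bij_comp bij_shift \<Gamma>_bij) auto

lemma window_eq:
  assumes "i < length es" "z \<in> cls {..<9}"
  shows "window i z = (es ! i) z"
proof -
  have "shift (offset i) z \<in> slot i" using shift_mem_slot assms cls_subset by blast
  then have "amal es (length es) (shift (offset i) z) = piece i (shift (offset i) z)"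
    using assms by (intro amal_slot) auto
  then show ?thesis unfolding window_def piece_def by simp
qed

lemma window_rest:
  assumes "z \<in> rest i" shows "window i z \<in> rest i"
proof -
  obtain l where l: "l < length es" "l \<noteq> i" "shift (offset i) z \<in> slot l" using assms unfolding rest_def by blast
  have "amal es (length es) (shift (offset i) z) \<in> slot l"
    using amal_slot[of "length es" l] piece_slot l by simp
  then show ?thesis using l shift_W slot_W unfolding rest_def window_def by auto
qed

lemma window_fix:
  assumes "i < length es" "z \<notin> cls {..<9}" "z \<notin> rest i"
  shows "window i z = z"
proof -
  have "shift (offset i) z \<notin> slot l" if "l < length es" for l
  proof (cases "z \<in> W")
    case True
    then show ?thesis using assms that shift_mem_slot[OF assms(1) True] unfolding rest_def by auto
  next
    case False
    then show ?thesis using slot_W by (auto simp: shift_out)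
  qed
  then have "amal es (length es) (shift (offset i) z) = shift (offset i) z" by (intro amal_fix) auto
  then show ?thesis unfolding window_def by simp
qed

lemma cls_rest_disjoint: "i < length es \<Longrightarrow> cls {..<9} \<inter> rest i = {}"
  using shift_mem_slot[of i] slot_disjoint unfolding rest_def by blast

text \<open>Since \<open>2 ^ i - 2 ^ j = 2 ^ l - 2 ^ l'\<close> has only the obvious solutions, and \<open>n\<close> is so large that
  offsets do not wrap around, the translates of the support of \<open>amal\<close> meet only in \<open>cls {..<9}\<close>.\<close>

lemma rest_disjoint:
  assumes "i < length es" "j < length es" "i \<noteq> j"
  shows "rest i \<inter> rest j = {}"
proof (rule ccontr)
  assume "rest i \<inter> rest j \<noteq> {}"
  then obtain z l l' where z: "z \<in> W" "l < length es" "l \<noteq> i" "shift (offset i) z \<in> slot l"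
    "l' < length es" "l' \<noteq> j" "shift (offset j) z \<in> slot l'"
    unfolding rest_def by blast
  obtain \<omega> c w where c: "\<omega> \<in> \<Omega>" "c < n" "w \<in> W" "z = cons (\<omega>, c) w" using z(1) by (rule W_cases)
  have a: "9 * 2 ^ l \<le> rot (offset i) c" "rot (offset i) c < 9 * 2 ^ l + 9"
    "9 * 2 ^ l' \<le> rot (offset j) c" "rot (offset j) c < 9 * 2 ^ l' + 9"
    using z(4,7) c by (simp_all add: slot_def rot_less)
  \<comment> \<open>\<open>r\<close> and \<open>r'\<close> are the positions inside the two slots,
    between 0 and 8.\<close>
  define r where "r = int (rot (offset i) c) - offset l"
  define r' where "r' = int (rot (offset j) c) - offset l'"
  have "int (9 * 2 ^ l) \<le> int (rot (offset i) c)" "int (rot (offset i) c) < int (9 * 2 ^ l + 9)"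
    "int (9 * 2 ^ l') \<le> int (rot (offset j) c)" "int (rot (offset j) c) < int (9 * 2 ^ l' + 9)"
    using a by (simp_all only: of_nat_le_iff of_nat_less_iff)
  then have r: "0 \<le> r" "r < 9" "0 \<le> r'" "r' < 9" unfolding r_def r'_def by simp_all
  have "int n > 0" using n_ge by simp
  then have "int (rot (offset i) c) = (int c + offset i) mod int n"
    "int (rot (offset j) c) = (int c + offset j) mod int n"
    using c(2) unfolding rot_def by simp_all
  then have "(int c + offset i) - (offset l + r) = int n * ((int c + offset i) div int n)"
     "(int c + offset j) - (offset l' + r') = int n * ((int c + offset j) div int n)"
    unfolding r_def r'_def by (simp_all add: minus_mod_eq_mult_div)
  \<comment> \<open>The difference between the numbers of wraps around the cycle of classes. By the
    size of \<open>n\<close> the left side of the resulting equation is less than \<open>n\<close>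
    in absolute value, which forces \<open>\<alpha> = 0\<close>.\<close>
  moreover define \<alpha> where "\<alpha> = (int c + offset i) div int n - (int c + offset j) div int n"
  ultimately have \<alpha>: "(offset i - offset j) - (offset l - offset l') - (r - r') = int n * \<alpha>"
    by (simp add: right_diff_distrib)
  have "0 < (2::int) ^ m" for m by simp
  then have "\<bar>int n * \<alpha>\<bar> < int n * 1"
    using length_bound(2)[OF assms(1)] length_bound(2)[OF assms(2)] length_bound(2)[OF z(2)] length_bound(2)[OF z(5)] r
    unfolding \<alpha>[symmetric] abs_less_iff by (smt (verit))
  then have "int n * \<bar>\<alpha>\<bar> < int n * 1" by (simp add: abs_mult)
  then have "\<alpha> = 0" using \<open>int n > 0\<close> unfolding mult_less_cancel_left_pos[OF \<open>int n > 0\<close>] by simp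
  with \<alpha> have eq: "9 * ((2::int) ^ i - 2 ^ j - 2 ^ l + 2 ^ l') = r - r'" by simp
  \<comment> \<open>A multiple of 9 that is a difference of two numbers between 0 and 8
    vanishes.\<close>
  have "x = 0" if "9 * x = r - r'" for x :: int using that r by presburger
  from this[OF eq] have "(2::int) ^ i - 2 ^ j - 2 ^ l + 2 ^ l' = 0" .
  then have "int (2 ^ i + 2 ^ l') = int (2 ^ j + 2 ^ l)" by simp
  then have "(2::nat) ^ i + 2 ^ l' = 2 ^ j + 2 ^ l" by (simp only: of_nat_eq_iff)
  \<comment> \<open>The Sidon property leaves \<open>i = j\<close> or \<open>i = l\<close>, and both
    are excluded.\<close>
  then show False using two_power_Sidon assms(3) z(3) by blast
qed

lemma comm_window:
  assumes "i < length es" "j < length es" "i \<noteq> j"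
  shows "comm (window i) (window j) = comm (es ! i) (es ! j)"
proof (rule comm_eq_of_disjoint_supports)
  show "bij (window i)" "bij (window j)" by (rule bij_window)+
  show "bij (es ! i)" "bij (es ! j)" using assms bij_E es_E by blast+
  show "window i z = (es ! i) z" "window j z = (es ! j) z" if "z \<in> cls {..<9}" for z
    using that assms window_eq by blast+
  show "(es ! i) z = z" "(es ! j) z = z" if "z \<notin> cls {..<9}" for z
    using that assms E_fix es_E by blast+
  show "window i z \<in> rest i" if "z \<in> rest i" for z using window_rest that .
  show "window j z \<in> rest j" if "z \<in> rest j" for z using window_rest that .
  show "window i z = z" if "z \<notin> cls {..<9}" "z \<notin> rest i" for z using window_fix that assms by blast
  show "window j z = z" if "z \<notin> cls {..<9}" "z \<notin> rest j" for z using window_fix that assms by blast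
qed (use assms cls_rest_disjoint rest_disjoint in auto)

lemma \<Gamma>_two_generated: "generate perm_grp {amal es (length es), shift 1} = \<Gamma>"
proof
  let ?G = "generate perm_grp {amal es (length es), shift 1}"
  show "?G \<subseteq> \<Gamma>" using amal_\<Gamma> shift_\<Gamma> by (intro gen_least[OF subgroup_\<Gamma>]) auto
  have bij: "{amal es (length es), shift 1} \<subseteq> {f. bij f}" using amal_\<Gamma> \<Gamma>_bij bij_shift by auto
  have shift: "shift k \<in> ?G" for k by (rule shift_gen[OF bij gen_incl]) simp
  have window: "window i \<in> ?G" for i
    unfolding window_def by (intro gen_comp shift gen_incl) auto
  have "g \<in> ?G" if gE: "g \<in> E" for g
  proof -
    obtain g1 g2 where g: "g1 \<in> E" "g2 \<in> E" "g = comm g1 g2" using E_comm[OF gE] .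
    then obtain i j where ij: "i < length es" "g1 = es ! i" "j < length es" "g2 = es ! j"
      using es(1) by (metis in_set_conv_nth)
    show ?thesis
    \<comment> \<open>Equal indices mean equal factors, whose commutator is the identity;
      \<open>comm_window\<close> speaks of distinct indices.\<close>
    proof (cases "i = j")
      case True
      then have "g = id" using g ij bij_E by (simp add: comm_def comp_assoc)
      then show ?thesis by (simp add: gen_id)
    next
      case False
      then have "g = comm (window i) (window j)" using comm_window g ij by simp
      then show ?thesis using gen_comm[OF bij window window] by simp
    qed
  qed
  then show "\<Gamma> \<subseteq> ?G"
    using shift by (intro \<Gamma>_least perm.generate_is_subgroup) (use bij in auto)
qed

end

lemma two_generated: "\<exists>a\<in>\<Gamma>. generate perm_grp {a, shift 1} = \<Gamma>"
proof -
  obtain es where "set es = E" "length es = card E"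
    using finite_distinct_list[OF finite_E] distinct_card by metis
  then show ?thesis using \<Gamma>_two_generated amal_\<Gamma> by blast
qed

end

section \<open>Commutators with a map that moves a support off itself\<close>

text \<open>\<open>comm g h\<close> equals \<open>g \<circ> k\<close>, where \<open>k\<close>, a
  conjugate of the inverse of \<open>g\<close> by \<open>h\<close>, is the identity on
  \<open>A\<close>. So \<open>k\<close> commutes with \<open>f\<close> and cancels from the outer
  commutator. Hence a normal subgroup containing \<open>h\<close> contains
  \<open>comm f g\<close>.\<close>

lemma comm_eq_comm_comm:
  assumes bij: "bij f" "bij g" "bij h"
    and supp: "\<And>z. z \<notin> A \<Longrightarrow> f z = z" "\<And>z. z \<notin> A \<Longrightarrow> g z = z"
    and off: "\<And>z. z \<in> A \<Longrightarrow> h z \<notin> A"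
  shows "comm f g = comm f (comm g h)"
proof -
  define k where "k = h \<circ> pinv g \<circ> pinv h"
  have k: "bij k" using bij unfolding k_def by (auto intro!: bij_comp)
  have kfix: "k z = z" if "z \<in> A" for z
  proof -
    have "pinv h z \<notin> A" using off[of "pinv h z"] that bij by auto
    then have "pinv g (pinv h z) = pinv h z" using supp(2) bij(2) by (metis pinv_simps(1))
    then show ?thesis using bij unfolding k_def by simp
  qed
  have fk: "f \<circ> k = k \<circ> f"
  proof
    fix z
    show "(f \<circ> k) z = (k \<circ> f) z"
    proof (cases "z \<in> A")
      case True
      then have "f z \<in> A" using supp(1) bij(1) by (metis pinv_simps(1))
      then show ?thesis using True kfix by simp
    next
      case False
      then have "k z \<notin> A" using kfix k by (metis pinv_simps(1))
      then show ?thesis using False supp by simp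
    qed
  qed
  have c: "comm g h = g \<circ> k" unfolding comm_def k_def by (simp add: comp_assoc)
  have pc: "pinv (comm g h) = pinv k \<circ> pinv g" unfolding c using bij(2) k by (rule pinv_comp)
  show ?thesis
  proof
    fix y
    define x where "x = pinv k (pinv g y)"
    have "f (k (pinv f x)) = k x" using fun_cong[OF fk, of "pinv f x"] bij(1) by simp
    then have "k (pinv f x) = pinv f (k x)" using bij(1) by (metis pinv_simps(1))
    also have "k x = pinv g y" using k unfolding x_def by simp
    finally show "comm f g y = comm f (comm g h) y"
      unfolding comm_def[of f "comm g h"] pc unfolding c comm_def[of f g] x_def by simp
  qed
qed

lemma comm_conj:
  assumes "bij f" "bij g" "bij h"
  shows "comm (h \<circ> f \<circ> pinv h) (h \<circ> g \<circ> pinv h) = h \<circ> comm f g \<circ> pinv h"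
proof -
  have "pinv h \<circ> (h \<circ> x) = x" for x :: "'a \<Rightarrow> 'a" using assms by (simp flip: comp_assoc)
  then show ?thesis
    using assms unfolding comm_def by (simp add: pinv_comp bij_comp pinv_pinv comp_assoc)
qed

context tower begin

subsection \<open>Local structure and displacement\<close>

definition local_at :: "('x \<Rightarrow> 'x) \<Rightarrow> 'x \<Rightarrow> bool" where
  "local_at g z \<longleftrightarrow> (\<exists>u v w. set u \<subseteq> B \<and> set v \<subseteq> B \<and> w \<in> W \<and> z = pre u w \<and> (\<forall>w'\<in>W. g (pre u w') = pre v w'))"

definition prefix_maps :: "('x \<Rightarrow> 'x) set" where
  "prefix_maps = {g. bij g \<and> (\<forall>z. z \<notin> W \<longrightarrow> g z = z) \<and> (\<forall>z\<in>W. local_at g z)}"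

lemma local_atI:
  "set u \<subseteq> B \<Longrightarrow> set v \<subseteq> B \<Longrightarrow> w \<in> W \<Longrightarrow> (\<And>w'. w' \<in> W \<Longrightarrow> g (pre u w') = pre v w') \<Longrightarrow> z = pre u w \<Longrightarrow> local_at g z"
  unfolding local_at_def by blast

text \<open>The prefixes \<open>v\<close> and \<open>u'\<close> of the point \<open>g z\<close> are
  comparable; the missing part \<open>t\<close> is appended to \<open>u\<close> if \<open>v\<close>
  is the shorter one, and to \<open>v'\<close> otherwise.\<close>

lemma local_at_comp:
  assumes "local_at g z" "local_at h (g z)"
  shows "local_at (h \<circ> g) z"
proof -
  obtain u v w where 1: "set u \<subseteq> B" "set v \<subseteq> B" "w \<in> W" "z = pre u w" "\<And>w'. w' \<in> W \<Longrightarrow> g (pre u w') = pre v w'"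
    using assms(1) unfolding local_at_def by blast
  obtain u' v' x where 2: "set u' \<subseteq> B" "set v' \<subseteq> B" "x \<in> W" "g z = pre u' x" "\<And>w'. w' \<in> W \<Longrightarrow> h (pre u' w') = pre v' w'"
    using assms(2) unfolding local_at_def by blast
  have "pre v w = pre u' x" using 1 2 by simp
  then consider t where "u' = v @ t" "w = pre t x" | t where "v = u' @ t" "x = pre t w"
    using pre_comparable[OF 1(2) 2(1) 1(3) 2(3)] by blast
  then show ?thesis
  proof cases
    case A: 1
    then have t: "set t \<subseteq> B" using 2(1) by simp
    show ?thesis
    proof (rule local_atI[where u = "u @ t" and v = v' and w = x])
      fix w' assume w': "w' \<in> W"
      then have "g (pre (u @ t) w') = pre u' w'" using 1(5)[of "pre t w'"] t A by simp
      then show "(h \<circ> g) (pre (u @ t) w') = pre v' w'" using 2(5)[OF w'] by simp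
    qed (use 1 2 A t in auto)
  next
    case A: 2
    then have t: "set t \<subseteq> B" using 1(2) by simp
    show ?thesis
    proof (rule local_atI[where u = u and v = "v' @ t" and w = w])
      fix w' assume w': "w' \<in> W"
      then have "h (g (pre u w')) = h (pre u' (pre t w'))" using 1(5) A by simp
      also have "\<dots> = pre (v' @ t) w'" using 2(5)[of "pre t w'"] w' t by simp
      finally show "(h \<circ> g) (pre u w') = pre (v' @ t) w'" by simp
    qed (use 1 2 A t in auto)
  qed
qed

lemma local_at_pinv:
  assumes "bij g" "local_at g (pinv g z)"
  shows "local_at (pinv g) z"
proof -
  obtain u v w where 1: "set u \<subseteq> B" "set v \<subseteq> B" "w \<in> W" "pinv g z = pre u w" "\<And>w'. w' \<in> W \<Longrightarrow> g (pre u w') = pre v w'"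
    using assms(2) unfolding local_at_def by blast
  show ?thesis
  proof (rule local_atI[where u = v and v = u and w = w])
    show "z = pre v w" using 1 assms(1) by (metis pinv_simps(2))
    show "pinv g (pre v w') = pre u w'" if "w' \<in> W" for w'
      using 1(5)[OF that] assms(1) by (metis pinv_simps(1))
  qed (use 1 in auto)
qed

lemma prefix_maps_stab: "g \<in> prefix_maps \<Longrightarrow> g \<in> stab W"
  unfolding prefix_maps_def by (rule fixoff_stab) auto

lemma subgroup_prefix_maps: "subgroup prefix_maps perm_grp"
proof (rule perm.subgroupI)
  have "local_at id z" if "z \<in> W" for z
    by (rule local_atI[where u = "[]" and v = "[]" and w = z]) (use that in auto)
  then have "id \<in> prefix_maps" unfolding prefix_maps_def by auto
  then show "prefix_maps \<noteq> {}" by blast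
  show "prefix_maps \<subseteq> carrier perm_grp" unfolding prefix_maps_def by auto
next
  fix g assume g: "g \<in> prefix_maps"
  then have "pinv g z \<in> W" if "z \<in> W" for z
    using that stab_mem[OF stab_pinv[OF prefix_maps_stab[OF g]]] by simp
  moreover have "pinv g z = z" if "z \<notin> W" for z
    using g that unfolding prefix_maps_def by (metis (mono_tags, lifting) mem_Collect_eq pinv_simps(1))
  ultimately have "pinv g \<in> prefix_maps"
    using g local_at_pinv unfolding prefix_maps_def by auto
  then show "inv\<^bsub>perm_grp\<^esub> g \<in> prefix_maps" using g unfolding prefix_maps_def by simp
next
  fix g h assume gh: "g \<in> prefix_maps" "h \<in> prefix_maps"
  then have "h z \<in> W" if "z \<in> W" for z using that stab_mem[OF prefix_maps_stab] by blast
  then have "g \<circ> h \<in> prefix_maps"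
    using gh local_at_comp[of h _ g] unfolding prefix_maps_def by (auto simp: bij_comp)
  then show "g \<otimes>\<^bsub>perm_grp\<^esub> h \<in> prefix_maps" by simp
qed

lemma lift_prefix_maps:
  assumes "p \<in> stab B" shows "lift p \<in> prefix_maps"
proof -
  have "local_at (lift p) z" if z: "z \<in> W" for z
  proof -
    obtain \<omega> i w where z: "\<omega> \<in> \<Omega>" "i < n" "w \<in> W" "z = cons (\<omega>, i) w" using z by (rule W_cases)
    show ?thesis
      by (rule local_atI[where u = "[(\<omega>, i)]" and v = "[p (\<omega>, i)]" and w = w])
        (use z stab_mem[OF assms, of "(\<omega>, i)"] in auto)
  qed
  then show ?thesis using assms unfolding prefix_maps_def by (auto simp: bij_lift lift_out)
qed

lemma dup_copy_cases:
  assumes "p \<in> stab {..<5}" "y \<in> cls {..<5}" "j < 5"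
  shows "dup p (dup_copy j y) = dup_copy (p j) y"
  unfolding dup_def using assms by (intro dups.act_in) auto

text \<open>On copy 0 the first letter decides. Elsewhere two letters are read, since membership in
  one of the copies 1 to 4 depends on the class of the second letter.\<close>

lemma dup_prefix_maps:
  assumes p: "p \<in> stab {..<5}" shows "dup p \<in> prefix_maps"
proof -
  have p5: "p j < 5" if "j < 5" for j using stab_mem[OF p, of j] that by simp
  have "local_at (dup p) z" if z: "z \<in> W" for z
  proof -
    obtain \<omega> i w where z: "\<omega> \<in> \<Omega>" "i < n" "w \<in> W" "z = cons (\<omega>, i) w" using z by (rule W_cases)
    obtain \<omega>' i' w' where w: "\<omega>' \<in> \<Omega>" "i' < n" "w' \<in> W" "w = cons (\<omega>', i') w'" using z(3) by (rule W_cases)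
    show ?thesis
    proof (cases "i < 5")
      case True
      show ?thesis
      proof (rule local_atI[where u = "[(\<omega>, i)]" and w = w and
            v = "if p 0 = 0 then [(\<omega>, i)] else [(base, 4 + p 0), (\<omega>, i)]"])
        fix x assume "x \<in> W"
        then show "dup p (pre [(\<omega>, i)] x) = pre (if p 0 = 0 then [(\<omega>, i)] else [(base, 4 + p 0), (\<omega>, i)]) x"
          using dup_copy_cases[OF p, of "cons (\<omega>, i) x" 0] z True by (simp add: dup_copy_def)
      qed (use z p5[of 0] n_ge base in auto)
    next
      case False
      show ?thesis
      proof (cases "\<omega> = base \<and> i < 9 \<and> i' < 5")
        case True
        \<comment> \<open>Undoes the offset in \<open>dup_copy\<close>: the first letter is that of
          copy \<open>j\<close>.\<close>
        define j where "j = i - 4"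
        have j: "i = 4 + j" "j < 5" "j \<noteq> 0" using True False unfolding j_def by auto
        show ?thesis
        proof (rule local_atI[where u = "[(\<omega>, i), (\<omega>', i')]" and w = w' and
              v = "if p j = 0 then [(\<omega>', i')] else [(base, 4 + p j), (\<omega>', i')]"])
          fix x assume "x \<in> W"
          then show "dup p (pre [(\<omega>, i), (\<omega>', i')] x) =
              pre (if p j = 0 then [(\<omega>', i')] else [(base, 4 + p j), (\<omega>', i')]) x"
            using dup_copy_cases[OF p, of "cons (\<omega>', i') x" j] w True j by (simp add: dup_copy_def)
        qed (use z w p5[of j] n_ge base j in auto)
      next
        case F: False
        show ?thesis
        proof (rule local_atI[where u = "[(\<omega>, i), (\<omega>', i')]" and w = w' and v = "[(\<omega>, i), (\<omega>', i')]"])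
          fix x assume x: "x \<in> W"
          have "pre [(\<omega>, i), (\<omega>', i')] x \<noteq> dup_copy j y" if "j \<in> {..<5}" "y \<in> cls {..<5}" for j y
          proof
            assume eq: "pre [(\<omega>, i), (\<omega>', i')] x = dup_copy j y"
            have "j \<noteq> 0"
            proof
              assume "j = 0"
              then have "cons (\<omega>, i) (cons (\<omega>', i') x) \<in> cls {..<5}" using eq that by (simp add: dup_copy_def)
              then show False using z w x False by simp
            qed
            moreover have "y \<in> W" using that(2) cls_subset by blast
            ultimately have "(\<omega>, i) = (base, 4 + j)" "y = cons (\<omega>', i') x"
              using eq that(1) z w x base n_ge by (auto simp: dup_copy_def)
            then show False using F that z w x by auto
          qed
          then show "dup p (pre [(\<omega>, i), (\<omega>', i')] x) = pre [(\<omega>, i), (\<omega>', i')] x"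
            unfolding dup_def by (rule dups.act_out)
        qed (use z w in auto)
      qed
    qed
  qed
  moreover have "dup p z = z" if "z \<notin> W" for z
    using that cls_subset by (intro dup_fix) blast
  ultimately show ?thesis using dups.bij_act[OF p] unfolding prefix_maps_def dup_def by auto
qed

lemma turn_prefix_maps:
  assumes p: "p \<in> stab {..<5}" shows "turn p \<in> prefix_maps"
proof -
  have p5: "p j < 5" if "j < 5" for j using stab_mem[OF p, of j] that by simp
  have "local_at (turn p) z" if z: "z \<in> W" for z
  proof -
    obtain \<omega> i w where z: "\<omega> \<in> \<Omega>" "i < n" "w \<in> W" "z = cons (\<omega>, i) w" using z by (rule W_cases)
    obtain \<omega>' i' w' where w: "\<omega>' \<in> \<Omega>" "i' < n" "w' \<in> W" "w = cons (\<omega>', i') w'" using z(3) by (rule W_cases)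
    show ?thesis
    proof (cases "\<omega> = base \<and> i < 5")
      case True
      \<comment> \<open>\<open>k\<close> is the class of the second letter before copy
        \<open>i\<close> was formed, \<open>k'\<close> the class after copy \<open>p i\<close> is
        formed; only index 0 involves the shift.\<close>
      define k where "k = (if i = 0 then rot (-1) i' else i')"
      define k' where "k' = (if p i = 0 then rot 1 k else k)"
      have k: "k < n" "k' < n" using w unfolding k_def k'_def by (auto simp: rot_less)
      show ?thesis
      proof (rule local_atI[where u = "[(\<omega>, i), (\<omega>', i')]" and w = w' and v = "[(base, p i), (\<omega>', k')]"])
        fix x assume x: "x \<in> W"
        have "pre [(\<omega>, i), (\<omega>', i')] x = turn_copy i (cons (\<omega>', k) x)"
          using True w x unfolding turn_copy_def k_def by (simp add: rot_rot rot_0 rot_less)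
        then have "turn p (pre [(\<omega>, i), (\<omega>', i')] x) = turn_copy (p i) (cons (\<omega>', k) x)"
          using True w x k unfolding turn_def by (simp add: turns.act_in)
        also have "\<dots> = pre [(base, p i), (\<omega>', k')] x"
          using w x k unfolding turn_copy_def k'_def by simp
        finally show "turn p (pre [(\<omega>, i), (\<omega>', i')] x) = pre [(base, p i), (\<omega>', k')] x" .
      qed (use z w k p5[of i] n_ge base True in auto)
    next
      case False
      show ?thesis
      proof (rule local_atI[where u = "[(\<omega>, i)]" and v = "[(\<omega>, i)]" and w = w])
        fix x assume x: "x \<in> W"
        have "pre [(\<omega>, i)] x \<noteq> turn_copy j y" if "j \<in> {..<5}" "y \<in> W" for j y
          using that False z x base n_ge shift_W[of y 1] unfolding turn_copy_def by auto
        then show "turn p (pre [(\<omega>, i)] x) = pre [(\<omega>, i)] x"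
          unfolding turn_def by (rule turns.act_out)
      qed (use z in auto)
    qed
  qed
  moreover have "turn p z = z" if "z \<notin> W" for z
    using that cls_subset by (intro turn_fix) blast
  ultimately show ?thesis using turns.bij_act[OF p] unfolding prefix_maps_def turn_def by auto
qed

lemma \<Gamma>_prefix_maps: "\<Gamma> \<subseteq> prefix_maps"
proof (rule \<Gamma>_least[OF subgroup_prefix_maps])
  have "shift 1 \<in> prefix_maps" unfolding shift_def by (intro lift_prefix_maps on_class_stab rot_stab)
  moreover have "twist q p \<in> prefix_maps" if "q \<in> insert id Q" "p \<in> three_cyc" for q p
    unfolding twist_def by (intro lift_prefix_maps twist_inner_stab Q_id_stab three_cyc_stab_n that)
  moreover have "dup p \<in> prefix_maps" "turn p \<in> prefix_maps" if "p \<in> three_cyc" for p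
    using that dup_prefix_maps turn_prefix_maps three_cyc_stab by blast+
  ultimately show "insert (shift 1) E \<subseteq> prefix_maps" unfolding E_def by auto
qed

text \<open>Near a moved point \<open>g\<close> replaces some prefix \<open>u\<close> by a different
  \<open>v\<close>. If neither extends the other, any letter can be appended to both; if one
  continues the other with \<open>b\<close>, appending a letter other than \<open>b\<close>
  separates the cones. Appending also makes the prefix nonempty.\<close>

lemma moves_cone_off_itself:
  assumes g: "g \<in> prefix_maps" "g \<noteq> id"
  obtains u where "u \<noteq> []" "set u \<subseteq> B" "\<And>w w'. w \<in> W \<Longrightarrow> w' \<in> W \<Longrightarrow> g (pre u w) \<noteq> pre u w'"
proof -
  obtain z where z: "g z \<noteq> z" using g(2) by (auto simp: fun_eq_iff)
  then have "local_at g z" using g unfolding prefix_maps_def by auto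
  then obtain u v w where uv: "set u \<subseteq> B" "set v \<subseteq> B" "w \<in> W" "z = pre u w" "\<And>w'. w' \<in> W \<Longrightarrow> g (pre u w') = pre v w'"
    unfolding local_at_def by blast
  have ne: "u \<noteq> v" using uv z by auto
  have other: "\<exists>c\<in>B. c \<noteq> b" for b
  proof -
    have "(base, 0) \<in> B" "(base, 1) \<in> B" "(base, 0::nat) \<noteq> (base, 1)" using base n_ge by auto
    then show ?thesis by metis
  qed
  have refine: "\<exists>c\<in>B. \<forall>w\<in>W. \<forall>w'\<in>W. pre (v @ [c]) w \<noteq> pre (u @ [c]) w'"
  proof (cases "\<exists>t. v = u @ t \<or> u = v @ t")
    case True
    then obtain b t where bt: "v = u @ b # t \<or> u = v @ b # t" using ne by (metis append_Nil2 list.exhaust)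
    obtain c where c: "c \<in> B" "c \<noteq> b" using other by blast
    have "pre (v @ [c]) w \<noteq> pre (u @ [c]) w'" if "w \<in> W" "w' \<in> W" for w w'
    proof
      assume "pre (v @ [c]) w = pre (u @ [c]) w'"
      from pre_comparable[OF _ _ that this] uv c
      have "(\<exists>t. u @ [c] = v @ [c] @ t) \<or> (\<exists>t. v @ [c] = u @ [c] @ t)" by auto
      with bt c(2) show False by force
    qed
    with c show ?thesis by blast
  next
    case False
    obtain c where c: "c \<in> B" using other by blast
    have "pre (v @ [c]) w \<noteq> pre (u @ [c]) w'" if "w \<in> W" "w' \<in> W" for w w'
    proof
      assume "pre (v @ [c]) w = pre (u @ [c]) w'"
      then have "pre v (pre [c] w) = pre u (pre [c] w')" by simp
      from pre_comparable[OF uv(2,1) _ _ this] that c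
      show False using False by auto
    qed
    with c show ?thesis by blast
  qed
  then obtain c where c: "c \<in> B" "\<And>w w'. w \<in> W \<Longrightarrow> w' \<in> W \<Longrightarrow> pre (v @ [c]) w \<noteq> pre (u @ [c]) w'" by blast
  show thesis
  proof (rule that[of "u @ [c]"])
    fix w w' assume w: "w \<in> W" "w' \<in> W"
    then have "g (pre (u @ [c]) w) = pre (v @ [c]) w" using uv(5)[of "cons c w"] c by simp
    then show "g (pre (u @ [c]) w) \<noteq> pre (u @ [c]) w'" using c(2)[OF w] by simp
  qed (use uv c in auto)
qed

section \<open>Bounded displacement\<close>

definition bounded_disp :: "('x \<Rightarrow> 'x) set" where
  "bounded_disp = {g \<in> stab W. \<exists>C. \<forall>z\<in>W. d z (g z) \<le> C}"

lemma bounded_dispI: "g \<in> stab W \<Longrightarrow> (\<And>z. z \<in> W \<Longrightarrow> d z (g z) \<le> C) \<Longrightarrow> g \<in> bounded_disp"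
  unfolding bounded_disp_def by blast

lemma subgroup_bounded_disp: "subgroup bounded_disp perm_grp"
proof (rule perm.subgroupI)
  have "id \<in> bounded_disp" by (rule bounded_dispI[where C = 0]) (auto simp: d_refl)
  then show "bounded_disp \<noteq> {}" by blast
  show "bounded_disp \<subseteq> carrier perm_grp" unfolding bounded_disp_def by (auto simp: stab_bij)
next
  fix g assume "g \<in> bounded_disp"
  then obtain C where g: "g \<in> stab W" "\<And>z. z \<in> W \<Longrightarrow> d z (g z) \<le> C" unfolding bounded_disp_def by blast
  have "pinv g \<in> bounded_disp"
  proof (rule bounded_dispI[where C = C])
    fix z assume z: "z \<in> W"
    then have "pinv g z \<in> W" using stab_mem[OF stab_pinv[OF g(1)]] by simp
    then show "d z (pinv g z) \<le> C" using g(2)[of "pinv g z"] g(1) z by (simp add: stab_bij d_sym)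
  qed (use g stab_pinv in auto)
  then show "inv\<^bsub>perm_grp\<^esub> g \<in> bounded_disp" using g by (simp add: stab_bij)
next
  fix g h assume "g \<in> bounded_disp" "h \<in> bounded_disp"
  then obtain C C' where g: "g \<in> stab W" "\<And>z. z \<in> W \<Longrightarrow> d z (g z) \<le> C"
    and h: "h \<in> stab W" "\<And>z. z \<in> W \<Longrightarrow> d z (h z) \<le> C'" unfolding bounded_disp_def by blast
  have "g \<circ> h \<in> bounded_disp"
  proof (rule bounded_dispI[where C = "C' + C"])
    fix z assume z: "z \<in> W"
    then have hz: "h z \<in> W" "g (h z) \<in> W" using stab_mem g h by metis+
    show "d z ((g \<circ> h) z) \<le> C' + C"
      using d_tri[OF z hz] g(2)[OF hz(1)] h(2)[OF z] by simp
  qed (rule stab_comp[OF g(1) h(1)])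
  then show "g \<otimes>\<^bsub>perm_grp\<^esub> h \<in> bounded_disp" by simp
qed

lemma lift_stab_W: "p \<in> stab B \<Longrightarrow> lift p \<in> stab W"
  by (rule prefix_maps_stab[OF lift_prefix_maps])

lemma on_class_bounded: "p \<in> stab {..<n} \<Longrightarrow> lift (on_class p) \<in> bounded_disp"
proof -
  assume p: "p \<in> stab {..<n}"
  obtain C where C: "\<And>\<omega> i j w. \<omega> \<in> \<Omega> \<Longrightarrow> i < n \<Longrightarrow> j < n \<Longrightarrow> w \<in> W \<Longrightarrow> d (cons (\<omega>, i) w) (cons (\<omega>, j) w) \<le> C"
    using d_class by blast
  show ?thesis
  proof (rule bounded_dispI[where C = C])
    fix z assume "z \<in> W"
    then show "d z (lift (on_class p) z) \<le> C"
    proof (rule W_cases)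
      fix \<omega> i w assume "\<omega> \<in> \<Omega>" "i < n" "w \<in> W" "z = cons (\<omega>, i) w"
      then show ?thesis using C stab_mem[OF p, of i] by simp
    qed
  qed (use p lift_stab_W on_class_stab in blast)
qed

lemma at_class_bounded:
  assumes "q \<in> insert id Q" shows "lift (at_class q i) \<in> bounded_disp"
proof -
  have q: "q \<in> stab \<Omega>" using assms Q_id_stab by blast
  have "\<exists>C. \<forall>\<omega>\<in>\<Omega>. \<forall>i<n. \<forall>w\<in>W. d (cons (\<omega>, i) w) (cons (q \<omega>, i) w) \<le> C"
    using assms d_letter by (cases "q = id") (auto simp: d_refl)
  then obtain C where C: "\<And>\<omega> i w. \<omega> \<in> \<Omega> \<Longrightarrow> i < n \<Longrightarrow> w \<in> W \<Longrightarrow> d (cons (\<omega>, i) w) (cons (q \<omega>, i) w) \<le> C"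
    by blast
  show ?thesis
  proof (rule bounded_dispI[where C = C])
    fix z assume "z \<in> W"
    then show "d z (lift (at_class q i) z) \<le> C"
    proof (rule W_cases)
      fix \<omega> j w assume "\<omega> \<in> \<Omega>" "j < n" "w \<in> W" "z = cons (\<omega>, j) w"
      then show ?thesis using C by (simp add: d_refl)
    qed
  qed (use q lift_stab_W at_class_stab in blast)
qed

text \<open>A point of a copy and its image are copies of the same \<open>y\<close>, and both lie
  within \<open>C\<close> of \<open>y\<close>.\<close>

lemma copies_bounded:
  assumes "copies J D e" "p \<in> stab J" "act J D e p \<in> stab W" "D \<subseteq> W"
    and e: "\<And>j y. j \<in> J \<Longrightarrow> y \<in> D \<Longrightarrow> e j y \<in> W"
    and C: "\<And>j y. j \<in> J \<Longrightarrow> y \<in> D \<Longrightarrow> d y (e j y) \<le> C"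
  shows "act J D e p \<in> bounded_disp"
proof -
  interpret copies J D e by fact
  show ?thesis
  proof (rule bounded_dispI[where C = "C + C"])
    fix z assume z: "z \<in> W"
    show "d z (act J D e p z) \<le> C + C"
    proof (cases z rule: copies_cases)
      case (1 j y)
      have pj: "p j \<in> J" using stab_mem assms(2) 1 by metis
      have "d (e j y) (e (p j) y) \<le> d (e j y) y + d y (e (p j) y)"
        using 1 e pj assms(4) by (intro d_tri) auto
      also have "\<dots> \<le> C + C"
        using C[OF 1(1,2)] C[OF pj 1(2)] d_sym[of "e j y" y] e 1 assms(4) by (simp add: subset_iff)
      finally show ?thesis using 1 by (simp add: act_in)
    next
      case 2
      then show ?thesis using z by (simp add: act_out d_refl)
    qed
  qed fact
qed

lemma \<Gamma>_bounded: "\<Gamma> \<subseteq> bounded_disp"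
proof (rule \<Gamma>_least[OF subgroup_bounded_disp])
  obtain C0 where C0: "\<And>i w. i < n \<Longrightarrow> w \<in> W \<Longrightarrow> d w (cons (base, i) w) \<le> C0" using d_base by blast
  have shift: "shift 1 \<in> bounded_disp" unfolding shift_def by (intro on_class_bounded rot_stab)
  then obtain C1 where C1: "\<And>w. w \<in> W \<Longrightarrow> d w (shift 1 w) \<le> C1" unfolding bounded_disp_def by blast
  have "twist q p \<in> bounded_disp" if "q \<in> insert id Q" "p \<in> three_cyc" for q p
  proof -
    let ?a = "lift (at_class q 0)"
    have a: "?a \<in> bounded_disp" by (rule at_class_bounded[OF that(1)])
    then have bij: "bij ?a" unfolding bounded_disp_def using stab_bij by blast
    have "pinv ?a \<in> bounded_disp"
      using subgroup.m_inv_closed[OF subgroup_bounded_disp a] bij by simp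
    moreover have "lift (on_class p) \<in> bounded_disp" by (intro on_class_bounded three_cyc_stab_n that)
    ultimately have "?a \<circ> lift (on_class p) \<circ> pinv ?a \<in> bounded_disp"
      using a subgroup.m_closed[OF subgroup_bounded_disp] by (metis perm_grp_simps(2))
    then show ?thesis using twist_conj[of q p] that Q_id_stab three_cyc_stab_n by simp
  qed
  moreover have "dup p \<in> bounded_disp" if "p \<in> three_cyc" for p
    unfolding dup_def
  proof (rule copies_bounded[where C = C0])
    show "act {..<5} (cls {..<5}) dup_copy p \<in> stab W"
      using prefix_maps_stab[OF dup_prefix_maps[OF three_cyc_stab[OF that]]] unfolding dup_def .
    fix j y assume "j \<in> {..<5::nat}" "y \<in> cls {..<5}"
    moreover from this have "y \<in> W" using cls_subset by blast
    ultimately show "dup_copy j y \<in> W" "d y (dup_copy j y) \<le> C0"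
      using C0[of "4 + j" y] base n_ge unfolding dup_copy_def by (auto simp: d_refl)
  qed (use that three_cyc_stab cls_subset dups.copies_axioms in auto)
  moreover have "turn p \<in> bounded_disp" if "p \<in> three_cyc" for p
    unfolding turn_def
  proof (rule copies_bounded[where C = "C1 + C0"])
    show "act {..<5} W turn_copy p \<in> stab W"
      using prefix_maps_stab[OF turn_prefix_maps[OF three_cyc_stab[OF that]]] unfolding turn_def .
    fix j y assume j: "j \<in> {..<5::nat}" and y: "y \<in> W"
    show "turn_copy j y \<in> W" using j y base n_ge shift_W unfolding turn_copy_def by auto
    have "d y (cons (base, j) (shift 1 y)) \<le> d y (shift 1 y) + d (shift 1 y) (cons (base, j) (shift 1 y))"
      using y j base n_ge shift_W by (intro d_tri) auto
    then show "d y (turn_copy j y) \<le> C1 + C0"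
      using C1[OF y] C0[of j "shift 1 y"] C0[of j y] j y n_ge shift_W unfolding turn_copy_def by auto
  qed (use that three_cyc_stab turns.copies_axioms in auto)
  ultimately show "insert (shift 1) E \<subseteq> bounded_disp" using shift unfolding E_def by auto
qed

subsection \<open>Transitivity on cones\<close>

definition lifts :: "('o \<times> nat \<Rightarrow> 'o \<times> nat) set" where
  "lifts = {p \<in> stab B. lift p \<in> \<Gamma>}"

lemma lifts_comp: "p \<in> lifts \<Longrightarrow> p' \<in> lifts \<Longrightarrow> p \<circ> p' \<in> lifts"
  unfolding lifts_def using stab_comp \<Gamma>_comp lift_comp by auto

lemma lifts_pinv: "p \<in> lifts \<Longrightarrow> pinv p \<in> lifts"
  unfolding lifts_def using stab_pinv \<Gamma>_pinv pinv_lift by fastforce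

lemma lifts_twist:
  assumes "q \<in> insert id Q" "p \<in> three_cyc"
  shows "at_class q 0 \<circ> on_class p \<circ> at_class (pinv q) 0 \<in> lifts"
proof -
  have "twist q p \<in> \<Gamma>" using assms unfolding E_def by (intro E_\<Gamma>) (auto simp: E_def)
  then show ?thesis
    using assms twist_inner_stab Q_id_stab three_cyc_stab_n unfolding lifts_def twist_def by blast
qed

lemma lifts_on_class: "p \<in> three_cyc \<Longrightarrow> on_class p \<in> lifts"
proof -
  assume p: "p \<in> three_cyc"
  have "at_class id 0 \<circ> on_class p \<circ> at_class (pinv id) 0 = on_class p" by (auto simp: fun_eq_iff)
  then show ?thesis using lifts_twist[of id p] p by simp
qed

text \<open>A single \<open>at_class q i\<close> need not lie in \<open>\<Gamma>\<close>, but \<open>q\<close> on class \<open>i\<close> compensated by its inverse on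
  class \<open>j\<close> does; the class \<open>j\<close> is then removed by taking commutators.\<close>

definition cross :: "('o \<Rightarrow> 'o) \<Rightarrow> nat \<Rightarrow> nat \<Rightarrow> 'o \<times> nat \<Rightarrow> 'o \<times> nat" where
  "cross q i j = at_class q i \<circ> at_class (pinv q) j"

lemma cross_conj:
  assumes "bij p"
  shows "on_class p \<circ> cross q i j \<circ> pinv (on_class p) = cross q (p i) (p j)"
proof
  fix x :: "'o \<times> nat"
  obtain \<omega> m where x: "x = (\<omega>, p m)" using assms by (metis pinv_simps(2) surj_pair)
  have "p m = p k \<longleftrightarrow> m = k" for k using assms by (metis pinv_simps(1))
  then show "(on_class p \<circ> cross q i j \<circ> pinv (on_class p)) x = cross q (p i) (p j) x"
    using assms by (simp add: x cross_def pinv_on_class)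
qed

definition crossable :: "('o \<Rightarrow> 'o) \<Rightarrow> bool" where
  "crossable q \<longleftrightarrow> (\<forall>i\<in>{0, 1, 2}. \<forall>j\<in>{0, 1, 2}. i \<noteq> j \<longrightarrow> cross q i j \<in> lifts)"

lemma crossable_Q:
  assumes "q \<in> insert id Q" shows "crossable q"
proof -
  have bij: "bij q" using assms Q_id_stab stab_bij by blast
  have c0: "cross q 0 j \<in> lifts" if jk: "j \<in> {1, 2}" "k \<in> {1, 2}" "j \<noteq> k" for j k
  proof -
    \<comment> \<open>This cycle takes class 0 to class \<open>j\<close>, so the twist times the
      inverse cycle leaves \<open>q\<close> on class 0 and the inverse of \<open>q\<close> on class
      \<open>j\<close>.\<close>
    let ?p = "cyc3 0 j k"
    have p: "?p \<in> three_cyc" using jk by (intro cyc3_mem) auto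
    have "(at_class q 0 \<circ> on_class ?p \<circ> at_class (pinv q) 0) \<circ> pinv (on_class ?p) \<in> lifts"
      using p assms by (intro lifts_comp lifts_pinv lifts_twist lifts_on_class)
    moreover have "(at_class q 0 \<circ> on_class ?p \<circ> at_class (pinv q) 0) \<circ> pinv (on_class ?p) = cross q 0 j"
      using jk by (auto simp: cross_def fun_eq_iff pinv_on_class pinv_cyc3 bij_cyc3 cyc3_def)
    ultimately show ?thesis by simp
  qed
  let ?r = "cyc3 0 1 2"
  have r: "?r \<in> three_cyc" by (intro cyc3_mem) auto
  \<comment> \<open>Conjugation by the cycle (0 1 2) reaches the remaining pairs of classes.\<close>
  have turn: "cross q (?r i) (?r j) \<in> lifts" if "cross q i j \<in> lifts" for i j
  proof -
    have "on_class ?r \<circ> cross q i j \<circ> pinv (on_class ?r) \<in> lifts"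
      using that r by (intro lifts_comp lifts_pinv lifts_on_class)
    moreover have "on_class ?r \<circ> cross q i j \<circ> pinv (on_class ?r) = cross q (?r i) (?r j)"
      by (rule cross_conj) (simp add: bij_cyc3)
    ultimately show ?thesis by simp
  qed
  have 1: "cross q 0 1 \<in> lifts" "cross q 0 2 \<in> lifts" using c0[of 1 2] c0[of 2 1] by auto
  have 2: "cross q 1 2 \<in> lifts" "cross q 1 0 \<in> lifts" using turn[OF 1(1)] turn[OF 1(2)] by (simp_all add: cyc3_def)
  have "cross q 2 0 \<in> lifts" "cross q 2 1 \<in> lifts" using turn[OF 2(1)] turn[OF 2(2)] by (simp_all add: cyc3_def)
  with 1 2 show ?thesis unfolding crossable_def by auto
qed

lemma crossable_pinv:
  assumes "bij q" "crossable q" shows "crossable (pinv q)"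
proof -
  have "cross (pinv q) i j = cross q j i" if "i \<noteq> j" for i j
    using that assms(1) by (auto simp: cross_def fun_eq_iff pinv_pinv)
  then show ?thesis using assms(2) unfolding crossable_def by metis
qed

lemma crossable_comp:
  assumes "bij q" "bij r" "crossable q" "crossable r" shows "crossable (q \<circ> r)"
proof -
  have "cross (q \<circ> r) i j \<in> lifts" if ij: "i \<in> {0, 1, 2}" "j \<in> {0, 1, 2}" "i \<noteq> j" for i j
  proof -
    \<comment> \<open>The third of the three classes. In the product below it receives
      \<open>q\<close> and the inverse of \<open>q\<close>, which cancel, while \<open>i\<close> and
      \<open>j\<close> collect \<open>q \<circ> r\<close> and its inverse.\<close>
    define k where "k = 3 - i - j"
    have k: "k \<in> {0, 1, 2}" "k \<noteq> i" "k \<noteq> j" using ij unfolding k_def by auto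
    have "cross q i k \<circ> cross r i j \<circ> cross q k j \<in> lifts"
      using assms ij k unfolding crossable_def by (intro lifts_comp) auto
    moreover have "cross q i k \<circ> cross r i j \<circ> cross q k j = cross (q \<circ> r) i j"
      using ij k assms by (auto simp: cross_def fun_eq_iff pinv_comp)
    ultimately show ?thesis by simp
  qed
  then show ?thesis unfolding crossable_def by blast
qed

lemma Q_bij: "Q \<subseteq> {q. bij q}"
  using Q_stab stab_bij by blast

lemma crossable_generate: "q \<in> generate perm_grp Q \<Longrightarrow> crossable q"
proof (induction rule: generate.induct)
  case one
  show ?case unfolding perm_grp_simps by (rule crossable_Q[OF insertI1])
next
  case (inv h)
  then show ?case using crossable_pinv[of h] crossable_Q[of h] Q_bij by auto
next
  case (eng h1 h2)
  then show ?case unfolding perm_grp_simps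
    by (intro crossable_comp) (use gen_bij[OF Q_bij] in blast)+
qed (simp add: crossable_Q)

text \<open>The two crosses share class 0 only, so their commutator is trivial on classes 1 and 2.
  The embedding of the given group enters \<open>\<Gamma>\<close> this way.\<close>

lemma commutator_at_class:
  assumes "q \<in> generate perm_grp Q" "r \<in> generate perm_grp Q"
  shows "lift (at_class (comm q r) 0) \<in> \<Gamma>"
proof -
  have bij: "bij q" "bij r" using assms gen_bij[OF Q_bij] by blast+
  have "cross q 0 1 \<in> lifts" "cross r 0 2 \<in> lifts"
    using assms crossable_generate unfolding crossable_def by auto
  then have "comm (cross q 0 1) (cross r 0 2) \<in> lifts"
    unfolding comm_def by (intro lifts_comp lifts_pinv)
  moreover have "comm (cross q 0 1) (cross r 0 2) = at_class (comm q r) 0"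
    using bij by (auto simp: comm_def cross_def fun_eq_iff pinv_comp pinv_at_class bij_at_class pinv_pinv)
  ultimately show ?thesis unfolding lifts_def by simp
qed

definition cone_eqv :: "('o \<times> nat) list \<Rightarrow> ('o \<times> nat) list \<Rightarrow> bool" (infix \<open>\<sim>\<close> 50) where
  "u \<sim> v \<longleftrightarrow> (\<exists>g\<in>\<Gamma>. \<forall>w\<in>W. g (pre u w) = pre v w)"

lemma cone_eqv_sym: "u \<sim> v \<Longrightarrow> v \<sim> u"
  unfolding cone_eqv_def by (metis \<Gamma>_bij \<Gamma>_pinv pinv_simps(1))

lemma cone_eqv_trans [trans]: "u \<sim> v \<Longrightarrow> v \<sim> t \<Longrightarrow> u \<sim> t"
  unfolding cone_eqv_def using \<Gamma>_comp by (metis comp_apply)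

lemma cone_eqv_append: "u \<sim> v \<Longrightarrow> set t \<subseteq> B \<Longrightarrow> u @ t \<sim> v @ t"
  unfolding cone_eqv_def by (metis foldr_append comp_apply pre_W)

text \<open>The shift changes the class. Inside class 0, transitivity provides a \<open>q\<close>
  taking \<open>base\<close> to the wanted letter, and \<open>cross q 0 1\<close> realizes it,
  whatever happens on class 1.\<close>

lemma letters_eqv:
  assumes "\<omega> \<in> \<Omega>" "i < n" "\<omega>' \<in> \<Omega>" "i' < n"
  shows "[(\<omega>, i)] \<sim> [(\<omega>', i')]"
proof -
  have *: "[(\<omega>, i)] \<sim> [(base, 0)]" if \<omega>: "\<omega> \<in> \<Omega>" "i < n" for \<omega> i
  proof -
    have rot: "rot (- int i) i = 0" using that n_ge by (subst rot_small) auto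
    have "[(\<omega>, i)] \<sim> [(\<omega>, 0)]" unfolding cone_eqv_def
      by (rule bexI[where x = "shift (- int i)"]) (use that rot shift_\<Gamma> in auto)
    also have "[(\<omega>, 0)] \<sim> [(base, 0)]"
    proof (rule cone_eqv_sym)
      obtain q where q: "q \<in> generate perm_grp Q" "q base = \<omega>" using transitive[OF \<omega>(1)] by blast
      have "cross q 0 1 \<in> lifts" using crossable_generate[OF q(1)] unfolding crossable_def by auto
      then have "lift (cross q 0 1) \<in> \<Gamma>" unfolding lifts_def by simp
      then show "[(base, 0)] \<sim> [(\<omega>, 0)]" unfolding cone_eqv_def
        by (rule bexI[rotated]) (use q base n_ge in \<open>auto simp: cross_def\<close>)
    qed
    finally show ?thesis .
  qed
  show ?thesis using cone_eqv_trans[OF *[OF assms(1,2)] cone_eqv_sym[OF *[OF assms(3,4)]]] .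
qed

definition std_cyc :: "nat \<Rightarrow> nat" where "std_cyc = cyc3 0 1 2"

lemma std_cyc_three_cyc: "std_cyc \<in> three_cyc"
  unfolding std_cyc_def by (rule cyc3_mem) auto

lemma std_cyc_apply: "std_cyc j = (if j = 0 then 1 else if j = 1 then 2 else if j = 2 then 0 else j)"
  unfolding std_cyc_def cyc3_def ..

lemma first_letter_eqv: "x \<in> B \<Longrightarrow> y \<in> B \<Longrightarrow> z \<in> B \<Longrightarrow> [x, z] \<sim> [y, z]"
  using cone_eqv_append[OF letters_eqv[of "fst x" "snd x" "fst y" "snd y"], of "[z]"] by auto

lemma dup_\<Gamma>: "dup std_cyc \<in> \<Gamma>"
  using std_cyc_three_cyc unfolding E_def by (intro E_\<Gamma>) (auto simp: E_def)

lemma turn_\<Gamma>: "turn std_cyc \<in> \<Gamma>"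
  using std_cyc_three_cyc unfolding E_def by (intro E_\<Gamma>) (auto simp: E_def)

lemma dup_cons:
  assumes "\<omega> \<in> \<Omega>" "i < 5" "w \<in> W"
  shows "dup std_cyc (cons (\<omega>, i) w) = cons (base, 5) (cons (\<omega>, i) w)"
  using dup_copy_cases[OF three_cyc_stab[OF std_cyc_three_cyc], of "cons (\<omega>, i) w" 0] assms n_ge
  by (simp add: dup_copy_def std_cyc_apply)

text \<open>The first letter can be chosen freely. Passing from copy 0 to copy 1,
  \<open>turn\<close> lowers the class of the second letter by one; once that class is 0,
  \<open>dup\<close> read backwards removes the first letter.\<close>

lemma two_letters_eqv:
  assumes "\<omega>' \<in> \<Omega>" "i' < n" "\<omega> \<in> \<Omega>" "i < n"
  shows "[(\<omega>', i'), (\<omega>, i)] \<sim> [(base, 0)]"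
proof -
  have step: "[(base, 0), (\<omega>, Suc i)] \<sim> [(base, 0), (\<omega>, i)]" if "Suc i < n" for i
  proof -
    have rot: "rot 1 i = Suc i" using that by (subst rot_small) auto
    have "[(base, 0), (\<omega>, Suc i)] \<sim> [(base, 1), (\<omega>, i)]" unfolding cone_eqv_def
    proof (rule bexI[where x = "turn std_cyc"], safe)
      fix w assume w: "w \<in> W"
      then have "cons (base, 0) (cons (\<omega>, Suc i) w) = turn_copy 0 (cons (\<omega>, i) w)"
        using that assms rot unfolding turn_copy_def by simp
      then show "turn std_cyc (pre [(base, 0), (\<omega>, Suc i)] w) = pre [(base, 1), (\<omega>, i)] w"
        using w that assms unfolding turn_def by (simp add: turns.act_in) (simp add: turn_copy_def std_cyc_apply)
    qed (rule turn_\<Gamma>)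
    also have "[(base, 1), (\<omega>, i)] \<sim> [(base, 0), (\<omega>, i)]"
      using that assms base n_ge by (intro first_letter_eqv) auto
    finally show ?thesis .
  qed
  have down: "[(base, 0), (\<omega>, i)] \<sim> [(base, 0), (\<omega>, 0)]" if "i < n" for i
    using that
  proof (induction i)
    case 0
    show ?case unfolding cone_eqv_def using \<Gamma>_id by (metis id_apply)
  next
    case (Suc i)
    then show ?case using cone_eqv_trans[OF step] by simp
  qed
  have "[(\<omega>', i'), (\<omega>, i)] \<sim> [(base, 0), (\<omega>, i)]"
    using assms base n_ge by (intro first_letter_eqv) auto
  also have "[(base, 0), (\<omega>, i)] \<sim> [(base, 0), (\<omega>, 0)]" by (rule down[OF assms(4)])
  also have "[(base, 0), (\<omega>, 0)] \<sim> [(base, 5), (\<omega>, 0)]"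
    using assms base n_ge by (intro first_letter_eqv) auto
  also have "[(base, 5), (\<omega>, 0)] \<sim> [(\<omega>, 0)]"
  proof (rule cone_eqv_sym)
    show "[(\<omega>, 0)] \<sim> [(base, 5), (\<omega>, 0)]" unfolding cone_eqv_def
      by (rule bexI[OF _ dup_\<Gamma>]) (use assms in \<open>simp add: dup_cons\<close>)
  qed
  also have "[(\<omega>, 0)] \<sim> [(base, 0)]" using assms base n_ge by (intro letters_eqv) auto
  finally show ?thesis .
qed

text \<open>Merging the first two letters into one shortens the word.\<close>

lemma words_eqv: "u \<noteq> [] \<Longrightarrow> set u \<subseteq> B \<Longrightarrow> u \<sim> [(base, 0)]"
proof (induction u rule: length_induct)
  case (1 u)
  consider x where "u = [x]" | x y t where "u = x # y # t" using 1(2) by (metis list.exhaust)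
  then show ?case
  proof cases
    case A: 1
    then show ?thesis using 1(3) base n_ge letters_eqv[of "fst x" "snd x" base 0] by auto
  next
    case A: 2
    have "[x, y] \<sim> [(base, 0)]" using A 1(3) two_letters_eqv[of "fst x" "snd x" "fst y" "snd y"] by auto
    then have "[x, y] @ t \<sim> [(base, 0)] @ t" using A 1(3) by (intro cone_eqv_append) auto
    moreover have "(base, 0) # t \<sim> [(base, 0)]" using 1(1) A 1(3) base n_ge by auto
    ultimately show ?thesis using A cone_eqv_trans[of u "(base, 0) # t"] by simp
  qed
qed

subsection \<open>Compression into a cone\<close>

text \<open>A translate of \<open>dup std_cyc\<close>: as long as nothing wraps around, it sends
  classes \<open>k\<close> to \<open>k + 4\<close> into the cone of \<open>(base, k + 5)\<close> and
  touches only classes \<open>k\<close> to \<open>k + 6\<close>.\<close>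

definition bump :: "nat \<Rightarrow> 'x \<Rightarrow> 'x" where
  "bump k = shift (int k) \<circ> dup std_cyc \<circ> shift (- int k)"

lemma bump_\<Gamma>: "bump k \<in> \<Gamma>"
  unfolding bump_def by (intro \<Gamma>_comp shift_\<Gamma> dup_\<Gamma>)

lemma bump_in:
  assumes "\<omega> \<in> \<Omega>" "k \<le> i" "i < k + 5" "k + 5 < n" "w \<in> W"
  shows "\<exists>w'\<in>W. bump k (cons (\<omega>, i) w) = cons (base, k + 5) w'"
proof -
  have "rot (- int k) i = i - k" using assms by (subst rot_small) auto
  moreover have "rot (int k) 5 = k + 5" using assms by (subst rot_small) auto
  ultimately have "bump k (cons (\<omega>, i) w) = cons (base, k + 5) (cons (\<omega>, i - k) w)"
    using assms base unfolding bump_def by (simp add: dup_cons)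
  then show ?thesis using assms by (intro bexI[of _ "cons (\<omega>, i - k) w"]) auto
qed

lemma dup_out:
  assumes "\<omega> \<in> \<Omega>" "i < n" "w \<in> W" "i \<notin> {..<7}"
  shows "dup std_cyc (cons (\<omega>, i) w) = cons (\<omega>, i) w"
proof (cases "cons (\<omega>, i) w" rule: dups.copies_cases)
  case (1 j y)
  have y: "y \<in> W" using 1 cls_subset by blast
  have "j \<noteq> 0"
  proof
    assume "j = 0"
    then have "cons (\<omega>, i) w \<in> cls {..<5}" using 1 by (simp add: dup_copy_def)
    then show False using assms by simp
  qed
  moreover from this have "i = 4 + j" using 1 assms y base n_ge by (simp add: dup_copy_def)
  ultimately have "std_cyc j = j" using assms by (simp add: std_cyc_apply)
  then show ?thesis unfolding dup_def 1(3) dups.act_in[OF 1(1,2)] by simp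
next
  case 2
  then show ?thesis unfolding dup_def by (rule dups.act_out)
qed

lemma bump_out:
  assumes "\<omega> \<in> \<Omega>" "i < n" "w \<in> W" "i < k \<or> k + 7 \<le> i" "k + 7 \<le> n"
  shows "bump k (cons (\<omega>, i) w) = cons (\<omega>, i) w"
proof -
  have "rot (- int k) i \<notin> {..<7}"
  proof
    assume r: "rot (- int k) i \<in> {..<7}"
    have "i = rot (int k) (rot (- int k) i)" by (simp add: rot_rot rot_0)
    also have "\<dots> = k + rot (- int k) i" using r assms by (subst rot_small) auto
    finally show False using r assms(4) by auto
  qed
  then show ?thesis using assms unfolding bump_def by (simp add: dup_out rot_less rot_rot rot_0)
qed

text \<open>\<open>bump 4\<close> moves classes 4 to 8 into class 9 and fixes classes 0 to 3;
  \<open>bump 0\<close> moves the latter into class 5 and fixes class 9; \<open>bump 5\<close>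
  collects both in one cone.\<close>

lemma compress:
  assumes "z \<in> cls {..<9}"
  shows "\<exists>w\<in>W. (bump 5 \<circ> bump 0 \<circ> bump 4) z = cons (base, 10) w"
  using assms
proof (rule cls_cases)
  fix \<omega> i w assume z: "\<omega> \<in> \<Omega>" "i < n" "i \<in> {..<9}" "w \<in> W" "z = cons (\<omega>, i) w"
  show ?thesis
  proof (cases "i < 4")
    case True
    then have "bump 4 z = z" using z n_ge by (simp add: bump_out)
    moreover obtain w1 where w1: "w1 \<in> W" "bump 0 z = cons (base, 5) w1"
      using bump_in[of \<omega> 0 i w] z True n_ge by auto
    moreover obtain w2 where "w2 \<in> W" "bump 5 (cons (base, 5) w1) = cons (base, 10) w2"
      using bump_in[of base 5 5 w1] base w1 n_ge by auto
    ultimately show ?thesis by auto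
  next
    case False
    then obtain w1 where w1: "w1 \<in> W" "bump 4 z = cons (base, 9) w1"
      using bump_in[of \<omega> 4 i w] z n_ge by auto
    moreover have "bump 0 (cons (base, 9) w1) = cons (base, 9) w1" using w1 base n_ge by (simp add: bump_out)
    moreover obtain w2 where "w2 \<in> W" "bump 5 (cons (base, 9) w1) = cons (base, 10) w2"
      using bump_in[of base 5 9 w1] base w1 n_ge by auto
    ultimately show ?thesis by auto
  qed
qed

lemma compress_into_cone:
  assumes "u \<noteq> []" "set u \<subseteq> B"
  obtains \<psi> where "\<psi> \<in> \<Gamma>" "\<And>z. z \<in> cls {..<9} \<Longrightarrow> \<psi> z \<in> pre u ` W"
proof -
  have "[(base, 10)] \<sim> u"
    using cone_eqv_trans[OF letters_eqv[of base 10 base 0] cone_eqv_sym[OF words_eqv[OF assms]]] base n_ge by simp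
  then obtain g where g: "g \<in> \<Gamma>" "\<And>w. w \<in> W \<Longrightarrow> g (cons (base, 10) w) = pre u w"
    unfolding cone_eqv_def by auto
  show thesis
  proof (rule that[of "g \<circ> (bump 5 \<circ> bump 0 \<circ> bump 4)"])
    show "g \<circ> (bump 5 \<circ> bump 0 \<circ> bump 4) \<in> \<Gamma>" by (intro \<Gamma>_comp g(1) bump_\<Gamma>)
    show "(g \<circ> (bump 5 \<circ> bump 0 \<circ> bump 4)) z \<in> pre u ` W" if "z \<in> cls {..<9}" for z
      using compress[OF that] g(2) by auto
  qed
qed

subsection \<open>Simplicity\<close>

text \<open>The cycle through 0, ..., 2m in this order. For \<open>n = 2 * m + 1\<close> it is the
  rotation of the classes by one.\<close>

definition long_cycle :: "nat \<Rightarrow> nat \<Rightarrow> nat" where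
  "long_cycle m j = (if j < 2 * m then Suc j else if j = 2 * m then 0 else j)"

lemma normal_subgroup_full:
  assumes N: "subgroup N perm_grp" "N \<subseteq> \<Gamma>"
    and conj: "\<And>g x. g \<in> \<Gamma> \<Longrightarrow> x \<in> N \<Longrightarrow> g \<circ> x \<circ> pinv g \<in> N"
    and nontrivial: "h \<in> N" "h \<noteq> id"
  shows "N = \<Gamma>"
proof -
  have N_comp: "x \<circ> y \<in> N" if "x \<in> N" "y \<in> N" for x y
    using subgroup.m_closed[OF N(1) that] by simp
  have N_pinv: "pinv x \<in> N" if "x \<in> N" for x
    using subgroup.m_inv_closed[OF N(1) that] that N(2) \<Gamma>_bij by auto
  have N_comm: "comm g x \<in> N" if "g \<in> \<Gamma>" "x \<in> N" for g x
    unfolding comm_def using N_comp[OF conj[OF that] N_pinv[OF that(2)]] .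
  have N_conj': "x \<in> N" if "g \<in> \<Gamma>" "g \<circ> x \<circ> pinv g \<in> N" for g x
  proof -
    have "pinv g \<circ> (g \<circ> x \<circ> pinv g) \<circ> pinv (pinv g) \<in> N"
      using conj[OF \<Gamma>_pinv[OF that(1)] that(2)] .
    moreover have "pinv g \<circ> (g \<circ> x \<circ> pinv g) \<circ> pinv (pinv g) = x"
      using \<Gamma>_bij[OF that(1)] by (auto simp: fun_eq_iff pinv_pinv)
    ultimately show ?thesis by simp
  qed
  have h: "h \<in> prefix_maps" "bij h" using nontrivial N(2) \<Gamma>_prefix_maps \<Gamma>_bij by auto
  obtain u where u: "u \<noteq> []" "set u \<subseteq> B" "\<And>w w'. w \<in> W \<Longrightarrow> w' \<in> W \<Longrightarrow> h (pre u w) \<noteq> pre u w'"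
    using moves_cone_off_itself[OF h(1) nontrivial(2)] by metis
  obtain \<psi> where \<psi>: "\<psi> \<in> \<Gamma>" "\<And>z. z \<in> cls {..<9} \<Longrightarrow> \<psi> z \<in> pre u ` W"
    using compress_into_cone[OF u(1,2)] by metis
  have E_N: "s \<in> N" if s: "s \<in> E" for s
  proof -
    obtain s1 s2 where s12: "s1 \<in> E" "s2 \<in> E" "s = comm s1 s2" using E_comm[OF s] .
    \<comment> \<open>Conjugation by \<open>\<psi>\<close> moves the supports of \<open>s1\<close>
      and \<open>s2\<close> into the cone of \<open>u\<close>, which \<open>h\<close> moves off
      itself.\<close>
    define f where "f = (\<lambda>x. \<psi> \<circ> x \<circ> pinv \<psi>)"
    have f_\<Gamma>: "f x \<in> \<Gamma>" if "x \<in> E" for x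
      unfolding f_def using E_\<Gamma>[OF that] \<psi>(1) by (intro \<Gamma>_comp \<Gamma>_pinv)
    have f_fix: "f x z = z" if "x \<in> E" "z \<notin> pre u ` W" for x z
    proof -
      have "pinv \<psi> z \<notin> cls {..<9}" using \<psi>(2)[of "pinv \<psi> z"] that(2) \<Gamma>_bij[OF \<psi>(1)] by auto
      then show ?thesis using E_fix[OF that(1)] \<Gamma>_bij[OF \<psi>(1)] unfolding f_def by simp
    qed
    have "comm (f s1) (f s2) = comm (f s1) (comm (f s2) h)"
    proof (rule comm_eq_comm_comm[where A = "pre u ` W"])
      show "bij (f s1)" "bij (f s2)" using f_\<Gamma> s12 \<Gamma>_bij by blast+
      show "f s1 z = z" "f s2 z = z" if "z \<notin> pre u ` W" for z using f_fix s12 that by blast+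
      show "h z \<notin> pre u ` W" if "z \<in> pre u ` W" for z using u(3) that by blast
    qed (rule h(2))
    also have "\<dots> \<in> N" using f_\<Gamma> s12 nontrivial(1) by (intro N_comm) auto
    finally have "\<psi> \<circ> s \<circ> pinv \<psi> \<in> N"
      using comm_conj[OF bij_E bij_E \<Gamma>_bij, OF s12(1,2) \<psi>(1)] unfolding f_def s12(3) by simp
    then show ?thesis by (rule N_conj'[OF \<psi>(1)])
  qed
  \<comment> \<open>Powers of the shift conjugate the cycle (0 1 2) of classes to every cycle of
    three consecutive classes.\<close>
  have cyc: "lift (on_class (cyc3 i (Suc i) (Suc (Suc i)))) \<in> N" if i: "Suc (Suc i) < n" for i
  proof -
    have "at_class id 0 \<circ> on_class std_cyc \<circ> at_class (pinv id) 0 = on_class std_cyc"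
      by (auto simp: fun_eq_iff)
    then have "twist id std_cyc = lift (on_class std_cyc)" unfolding twist_def by simp
    moreover have "twist id std_cyc \<in> E" using std_cyc_three_cyc unfolding E_def by auto
    ultimately have "lift (on_class std_cyc) \<in> N" using E_N by simp
    then have "shift (int i) \<circ> lift (on_class std_cyc) \<circ> shift (- int i) \<in> N"
      using conj[OF shift_\<Gamma>[of "int i"]] by (simp add: pinv_shift)
    moreover have "shift (int i) \<circ> lift (on_class std_cyc) \<circ> shift (- int i)
        = lift (on_class (rot (int i)) \<circ> (on_class std_cyc) \<circ> on_class (rot (- int i)))"
      unfolding shift_def using std_cyc_three_cyc
      by (simp add: lift_comp on_class_stab rot_stab three_cyc_stab_n stab_comp)
    moreover have "rot (int i) (std_cyc (rot (- int i) j)) = cyc3 i (Suc i) (Suc (Suc i)) j" if j: "j < n" for j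
    proof -
      have r: "rot (int i) 0 = i" "rot (int i) 1 = Suc i" "rot (int i) 2 = Suc (Suc i)"
        using i by (simp_all add: rot_small nat_add_distrib)
      have unrot: "rot (int i) (rot (- int i) j) = j" by (simp add: rot_rot rot_0)
      have fwd: "rot (- int i) (rot (int i) k) = k" for k by (simp add: rot_rot rot_0)
      show ?thesis
      proof (cases "j \<in> {i, Suc i, Suc (Suc i)}")
        case True
        then show ?thesis using fwd[of 0] fwd[of 1] fwd[of 2] unfolding r by (auto simp: cyc3_def std_cyc_apply r r(2)[unfolded One_nat_def])
      next
        case False
        then have "rot (- int i) j \<noteq> 0" "rot (- int i) j \<noteq> 1" "rot (- int i) j \<noteq> 2"
          using unrot r by (metis insertCI)+
        then show ?thesis using False unrot by (simp add: cyc3_def std_cyc_apply)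
      qed
    qed
    ultimately show ?thesis
      using lift_cong[of "on_class (rot (int i)) \<circ> (on_class std_cyc) \<circ> on_class (rot (- int i))"
        "on_class (cyc3 i (Suc i) (Suc (Suc i)))"] by simp
  qed
  have long: "lift (on_class (long_cycle m)) \<in> N" if "2 * m < n" for m
    using that
  proof (induction m)
    case 0
    have "on_class (long_cycle 0) = id" by (auto simp: fun_eq_iff long_cycle_def)
    then show ?case using subgroup.one_closed[OF N(1)] by (simp only: lift_id perm_grp_simps)
  next
    case (Suc m)
    let ?c = "cyc3 (2 * m) (Suc (2 * m)) (Suc (Suc (2 * m)))"
    have c: "?c \<in> stab {..<n}" using Suc.prems by (intro cyc3_stab) auto
    \<comment> \<open>The two cycles share just the point 2m, so their product is a single cycle
      with two more points.\<close>
    have "long_cycle (Suc m) = long_cycle m \<circ> ?c"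
      by (auto simp: fun_eq_iff long_cycle_def cyc3_def)
    then have "lift (on_class (long_cycle (Suc m))) = lift (on_class (long_cycle m)) \<circ> lift (on_class ?c)"
      using c by (simp add: on_class_comp lift_comp on_class_stab)
    moreover have "lift (on_class (long_cycle m)) \<in> N" "lift (on_class ?c) \<in> N"
      using Suc cyc[of "2 * m"] by simp_all
    ultimately show ?case using N_comp by (simp only:)
  qed
  \<comment> \<open>Here the oddness of \<open>n\<close> enters: it makes the rotation by one a
    cycle of odd length.\<close>
  obtain m where m: "n = 2 * m + 1" using n_odd oddE by blast
  have "shift 1 = lift (on_class (long_cycle m))"
    unfolding shift_def
  proof (rule lift_cong)
    fix \<omega> i assume i: "i < n"
    have "rot 1 i = long_cycle m i"
    proof (cases "i = 2 * m")
      case True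
      then have "int i + 1 = int n" using m by simp
      then show ?thesis using i True unfolding rot_def long_cycle_def by simp
    next
      case False
      then have "i < 2 * m" using i m by simp
      moreover from this have "rot 1 i = nat (int i + 1)" using i m by (intro rot_small) auto
      ultimately show ?thesis unfolding long_cycle_def by simp
    qed
    then show "on_class (rot 1) (\<omega>, i) = on_class (long_cycle m) (\<omega>, i)" by simp
  qed
  then have "insert (shift 1) E \<subseteq> N" using E_N long[of m] m by auto
  then show ?thesis using \<Gamma>_least[OF N(1)] N(2) by blast
qed

lemma simple_\<Gamma>: "simple_grp (perm_grp\<lparr>carrier := \<Gamma>\<rparr>)"
proof -
  let ?G = "perm_grp\<lparr>carrier := \<Gamma>\<rparr>"
  have G: "group ?G" by (rule perm.subgroup_imp_group[OF subgroup_\<Gamma>])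
  have inv: "inv\<^bsub>?G\<^esub> g = pinv g" if "g \<in> \<Gamma>" for g
    using perm.m_inv_consistent[OF subgroup_\<Gamma> that] \<Gamma>_bij[OF that] by simp
  have "shift 1 \<noteq> id"
  proof
    assume "shift 1 = id"
    obtain w where w: "w \<in> W" using W_nonempty by blast
    have "shift 1 (cons (base, 0) w) = cons (base, 1) w"
      using w base n_ge by (simp add: rot_def)
    with \<open>shift 1 = id\<close> w base n_ge show False by simp
  qed
  then have "carrier ?G \<noteq> {\<one>\<^bsub>?G\<^esub>}" using shift_\<Gamma>[of 1] by auto
  moreover have "M = {\<one>\<^bsub>?G\<^esub>} \<or> M = carrier ?G" if M: "M \<lhd> ?G" for M
  proof (cases "M = {id}")
    case False
    have sub: "subgroup M ?G" using M by (rule normal_imp_subgroup)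
    then have sub': "subgroup M perm_grp" by (rule perm.incl_subgroup[OF subgroup_\<Gamma>])
    have "id \<in> M" using subgroup.one_closed[OF sub'] by simp
    then obtain h where "h \<in> M" "h \<noteq> id" using False by blast
    moreover have "M \<subseteq> \<Gamma>" using subgroup.subset[OF sub] by simp
    moreover have "g \<circ> x \<circ> pinv g \<in> M" if "g \<in> \<Gamma>" "x \<in> M" for g x
      using normal.inv_op_closed2[OF M, of g x] that inv by simp
    ultimately have "M = \<Gamma>" using normal_subgroup_full[OF sub'] by blast
    then show ?thesis by simp
  qed simp
  ultimately show ?thesis using G unfolding simple_grp_def by blast
qed

end

section \<open>The embedding\<close>

context group begin

text \<open>The action on all levels from 0 upward that the swindle uses. Pairs outside the carrier
  stay put so that this is a bijection of the whole type.\<close>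

definition half_mult :: "'a \<Rightarrow> 'a \<times> int \<Rightarrow> 'a \<times> int" where
  "half_mult h = (\<lambda>(x, k). (if x \<in> carrier G \<and> k \<ge> 0 then h \<otimes> x else x, k))"

definition step :: "int \<Rightarrow> 'a \<times> int \<Rightarrow> 'a \<times> int" where
  "step m = (\<lambda>(x, k). (x, k + m))"

definition zero_mult :: "'a \<Rightarrow> 'a \<times> int \<Rightarrow> 'a \<times> int" where
  "zero_mult h = (\<lambda>(x, k). (if x \<in> carrier G \<and> k = 0 then h \<otimes> x else x, k))"

lemma half_mult_comp:
  "h \<in> carrier G \<Longrightarrow> h' \<in> carrier G \<Longrightarrow> half_mult h \<circ> half_mult h' = half_mult (h \<otimes> h')"
  by (auto simp: half_mult_def fun_eq_iff m_assoc)

lemma half_mult_one: "half_mult \<one> = id"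
  by (auto simp: half_mult_def fun_eq_iff)

lemma bij_half_mult: "h \<in> carrier G \<Longrightarrow> bij (half_mult h)"
  by (rule o_bij[of "half_mult (inv h)"]) (simp_all add: half_mult_comp half_mult_one)

lemma pinv_half_mult: "h \<in> carrier G \<Longrightarrow> pinv (half_mult h) = half_mult (inv h)"
  by (rule pinv_eqI) (simp_all add: bij_half_mult half_mult_comp half_mult_one)

lemma step_comp: "step m \<circ> step m' = step (m + m')"
  by (auto simp: step_def fun_eq_iff)

lemma step_0: "step 0 = id"
  by (auto simp: step_def fun_eq_iff)

lemma bij_step: "bij (step m)"
  by (rule o_bij[of "step (- m)"]) (simp_all add: step_comp step_0)

lemma pinv_step: "pinv (step m) = step (- m)"
  by (rule pinv_eqI) (simp_all add: bij_step step_comp step_0)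

lemma zero_mult_comp:
  "h \<in> carrier G \<Longrightarrow> h' \<in> carrier G \<Longrightarrow> zero_mult h \<circ> zero_mult h' = zero_mult (h \<otimes> h')"
  by (auto simp: zero_mult_def fun_eq_iff m_assoc)

text \<open>Conjugation by the step turns the action on levels from 0 on into the one on levels from
  1 on; the inverse of the latter cancels everything but level 0.\<close>

lemma zero_mult_eq_comm: "h \<in> carrier G \<Longrightarrow> zero_mult h = comm (half_mult h) (step 1)"
  unfolding comm_def pinv_half_mult pinv_step
  by (auto simp: fun_eq_iff zero_mult_def half_mult_def step_def simp flip: m_assoc)

lemma half_mult_stab: "h \<in> carrier G \<Longrightarrow> half_mult h \<in> stab (carrier G \<times> UNIV)"
  by (rule fixoff_stab[OF bij_half_mult]) (auto simp: half_mult_def)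

lemma step_stab: "step m \<in> stab (carrier G \<times> UNIV)"
proof -
  have "z \<in> step m ` (carrier G \<times> UNIV)" if "z \<in> carrier G \<times> UNIV" for z
    using that by (intro image_eqI[of _ _ "(fst z, snd z - m)"]) (auto simp: step_def)
  then show ?thesis unfolding stab_def using bij_step by (auto simp: step_def)
qed

section \<open>The group acting on the letters, and eventually constant sequences\<close>

definition letter_perms :: "'a set \<Rightarrow> ('a \<times> int \<Rightarrow> 'a \<times> int) set" where
  "letter_perms S = insert (step 1) (half_mult ` S)"

lemma letter_perms_bij: "S \<subseteq> carrier G \<Longrightarrow> letter_perms S \<subseteq> {q. bij q}"
  unfolding letter_perms_def using bij_half_mult bij_step by auto

lemma half_mult_generate:
  assumes "S \<subseteq> carrier G" "h \<in> generate G S"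
  shows "half_mult h \<in> generate perm_grp (letter_perms S)"
  using assms(2)
proof (induction rule: generate.induct)
  case one
  show ?case unfolding half_mult_one by (rule gen_id)
next
  case (incl h)
  then show ?case unfolding letter_perms_def by (intro gen_incl) simp
next
  case (inv h)
  then have "half_mult h \<in> generate perm_grp (letter_perms S)"
    unfolding letter_perms_def by (intro gen_incl) simp
  from gen_pinv[OF letter_perms_bij[OF assms(1)] this] show ?case
    using inv assms(1) by (metis pinv_half_mult subsetD)
next
  case (eng h1 h2)
  then have "h1 \<in> carrier G" "h2 \<in> carrier G" using generate_in_carrier[OF assms(1)] by blast+
  then show ?case using gen_comp[OF eng.IH] by (simp only: half_mult_comp)
qed

lemma step_generate:
  assumes "S \<subseteq> carrier G"
  shows "step m \<in> generate perm_grp (letter_perms S)"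
proof -
  let ?G = "generate perm_grp (letter_perms S)"
  have 1: "step 1 \<in> ?G" unfolding letter_perms_def by (intro gen_incl) simp
  have nat: "step (int k) \<in> ?G" for k
  proof (induction k)
    case 0
    show ?case unfolding of_nat_0 step_0 by (rule gen_id)
  next
    case (Suc k)
    have "step (int (Suc k)) = step 1 \<circ> step (int k)" by (simp add: step_comp)
    then show ?case using gen_comp[OF 1 Suc] by (simp only:)
  qed
  show ?thesis
  proof (cases "m \<ge> 0")
    case True
    then show ?thesis using nat[of "nat m"] by simp
  next
    case False
    then have "step m = pinv (step (int (nat (- m))))" by (simp add: pinv_step)
    then show ?thesis using gen_pinv[OF letter_perms_bij[OF assms] nat] by (simp only:)
  qed
qed

lemma letter_perms_transitive:
  assumes "S \<subseteq> carrier G" "generate G S = carrier G" "\<omega> \<in> carrier G \<times> UNIV"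
  shows "\<exists>q\<in>generate perm_grp (letter_perms S). q (\<one>, 0) = \<omega>"
proof (rule bexI[where x = "step (snd \<omega>) \<circ> half_mult (fst \<omega>)"])
  show "step (snd \<omega>) \<circ> half_mult (fst \<omega>) \<in> generate perm_grp (letter_perms S)"
    using assms by (intro gen_comp half_mult_generate step_generate) auto
  show "(step (snd \<omega>) \<circ> half_mult (fst \<omega>)) (\<one>, 0) = \<omega>"
    using assms(3) by (auto simp: step_def half_mult_def)
qed

text \<open>A list stands for the infinite sequence that continues it by the letter \<open>((\<one>, 0), 0)\<close>.\<close>

definition seqs :: "nat \<Rightarrow> (('a \<times> int) \<times> nat) list set" where
  "seqs n = {ws. set ws \<subseteq> (carrier G \<times> UNIV) \<times> {..<n} \<and> (ws \<noteq> [] \<longrightarrow> last ws \<noteq> ((\<one>, 0), 0))}"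

text \<open>Prepending the base letter to the constant base sequence gives that sequence again; the
  case distinction keeps the representation by lists unique.\<close>

definition seq_cons :: "('a \<times> int) \<times> nat \<Rightarrow> (('a \<times> int) \<times> nat) list \<Rightarrow> (('a \<times> int) \<times> nat) list" where
  "seq_cons b ws = (if ws = [] \<and> b = ((\<one>, 0), 0) then [] else b # ws)"

text \<open>The map called pi in the introduction. The base letter has trivial group component, so
  the infinite tail contributes nothing.\<close>

definition seq_prod :: "(('a \<times> int) \<times> nat) list \<Rightarrow> 'a" where
  "seq_prod ws = foldr (\<lambda>b y. fst (fst b) \<otimes> y) ws \<one>"

text \<open>With the inverse on the right, a common tail of the two sequences cancels, and left
  multiplication by \<open>s\<close> displaces a point by the length of \<open>s\<close>. Distinct
  sequences can have distance 0.\<close>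

definition seq_dist :: "'a set \<Rightarrow> (('a \<times> int) \<times> nat) list \<Rightarrow> (('a \<times> int) \<times> nat) list \<Rightarrow> nat" where
  "seq_dist S z z' = word_length G S (seq_prod z \<otimes> inv (seq_prod z'))"

lemma seq_prod_closed: "z \<in> seqs n \<Longrightarrow> seq_prod z \<in> carrier G"
proof -
  have "set z \<subseteq> (carrier G \<times> UNIV) \<times> {..<n} \<Longrightarrow> seq_prod z \<in> carrier G"
    unfolding seq_prod_def by (induction z) auto
  then show "z \<in> seqs n \<Longrightarrow> seq_prod z \<in> carrier G" unfolding seqs_def by simp
qed

lemma seq_prod_cons: "seq_prod (seq_cons ((x, k), i) w) = x \<otimes> seq_prod w"
  unfolding seq_prod_def seq_cons_def by auto

lemma seq_cons_inj: "inj_on (\<lambda>(b, w). seq_cons b w) (((carrier G \<times> UNIV) \<times> {..<n}) \<times> seqs n)"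
  by (auto simp: inj_on_def seq_cons_def split: if_splits)

lemma seq_cons_image:
  assumes "n > 0"
  shows "(\<lambda>(b, w). seq_cons b w) ` (((carrier G \<times> UNIV) \<times> {..<n}) \<times> seqs n) = seqs n"
proof
  show "(\<lambda>(b, w). seq_cons b w) ` (((carrier G \<times> UNIV) \<times> {..<n}) \<times> seqs n) \<subseteq> seqs n"
    unfolding seqs_def by (auto simp: seq_cons_def split: if_splits)
  show "seqs n \<subseteq> (\<lambda>(b, w). seq_cons b w) ` (((carrier G \<times> UNIV) \<times> {..<n}) \<times> seqs n)"
  proof
    fix z assume z: "z \<in> seqs n"
    show "z \<in> (\<lambda>(b, w). seq_cons b w) ` (((carrier G \<times> UNIV) \<times> {..<n}) \<times> seqs n)"
    proof (cases z)
      case Nil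
      have "(((\<one>, 0), 0), []) \<in> ((carrier G \<times> UNIV) \<times> {..<n}) \<times> seqs n"
        using assms by (simp add: seqs_def)
      then show ?thesis unfolding Nil by (rule rev_image_eqI) (simp add: seq_cons_def)
    next
      case (Cons b w)
      then have "(b, w) \<in> ((carrier G \<times> UNIV) \<times> {..<n}) \<times> seqs n"
        using z by (auto simp: seqs_def split: if_splits)
      then show ?thesis by (rule rev_image_eqI) (use z in \<open>auto simp: Cons seq_cons_def seqs_def\<close>)
    qed
  qed
qed

text \<open>Levels and classes are invisible to \<open>seq_prod\<close>, and the base letter has
  trivial group component. So only \<open>half_mult s\<close> can displace points, and by no more
  than the length of \<open>inv s\<close>.\<close>

lemma tower_seqs:
  assumes S: "fin_gen_set G S"
    and n: "n = 18 * 2 ^ ((card (letter_perms S) + 3) * card three_cyc) + 9"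
  shows "tower (carrier G \<times> UNIV) (\<one>, 0) (letter_perms S) n (seqs n) seq_cons (seq_dist S)"
proof
  have S': "finite S" "S \<subseteq> carrier G" "generate G S = carrier G" using S unfolding fin_gen_set_def by auto
  show "(\<one>, 0::int) \<in> carrier G \<times> UNIV" by simp
  show "finite (letter_perms S)" unfolding letter_perms_def using S' by simp
  show "letter_perms S \<subseteq> stab (carrier G \<times> UNIV)"
    unfolding letter_perms_def using S' half_mult_stab step_stab by auto
  show "\<exists>q\<in>generate perm_grp (letter_perms S). q (\<one>, 0) = \<omega>" if "\<omega> \<in> carrier G \<times> UNIV" for \<omega>
    using letter_perms_transitive S' that by blast
  show "inj_on (\<lambda>(b, w). seq_cons b w) (((carrier G \<times> UNIV) \<times> {..<n}) \<times> seqs n)" by (rule seq_cons_inj)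
  show "(\<lambda>(b, w). seq_cons b w) ` (((carrier G \<times> UNIV) \<times> {..<n}) \<times> seqs n) = seqs n"
    by (rule seq_cons_image) (simp add: n)
  have "[] \<in> seqs n" unfolding seqs_def by simp
  then show "seqs n \<noteq> {}" by blast
  show "odd n" unfolding n by simp
  show "18 * 2 ^ ((card (letter_perms S) + 3) * card three_cyc) + 9 \<le> n" unfolding n by simp
  show "seq_dist S z z = 0" if "z \<in> seqs n" for z
    using seq_prod_closed[OF that] unfolding seq_dist_def by (simp add: word_length_one)
  show "seq_dist S z z' = seq_dist S z' z" if "z \<in> seqs n" "z' \<in> seqs n" for z z'
  proof -
    have c: "seq_prod z \<in> carrier G" "seq_prod z' \<in> carrier G" using seq_prod_closed that by blast+
    then have "inv (seq_prod z \<otimes> inv (seq_prod z')) = seq_prod z' \<otimes> inv (seq_prod z)"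
      by (simp add: inv_mult_group)
    then show ?thesis
      using word_length_inv[OF S, of "seq_prod z \<otimes> inv (seq_prod z')"] c unfolding seq_dist_def by simp
  qed
  show "seq_dist S z z'' \<le> seq_dist S z z' + seq_dist S z' z''"
    if "z \<in> seqs n" "z' \<in> seqs n" "z'' \<in> seqs n" for z z' z''
  proof -
    have c: "seq_prod z \<in> carrier G" "seq_prod z' \<in> carrier G" "seq_prod z'' \<in> carrier G"
      using seq_prod_closed that by blast+
    then have "(seq_prod z \<otimes> inv (seq_prod z')) \<otimes> (seq_prod z' \<otimes> inv (seq_prod z''))
        = seq_prod z \<otimes> inv (seq_prod z'')"
      by (metis inv_closed inv_solve_right m_assoc m_closed)
    then show ?thesis
      using word_length_mult[OF S, of "seq_prod z \<otimes> inv (seq_prod z')" "seq_prod z' \<otimes> inv (seq_prod z'')"] c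
      unfolding seq_dist_def by simp
  qed
  show "\<exists>C. \<forall>\<omega>\<in>carrier G \<times> UNIV. \<forall>i<n. \<forall>w\<in>seqs n. seq_dist S (seq_cons (\<omega>, i) w) (seq_cons (q \<omega>, i) w) \<le> C"
    if q: "q \<in> letter_perms S" for q
  proof -
    consider "q = step 1" | s where "s \<in> carrier G" "q = half_mult s"
      using q S' unfolding letter_perms_def by auto
    then show ?thesis
    proof cases
      case 1
      have "seq_dist S (seq_cons (\<omega>, i) w) (seq_cons (q \<omega>, i) w) \<le> 0"
        if "\<omega> \<in> carrier G \<times> UNIV" "w \<in> seqs n" for \<omega> i w
        using that seq_prod_closed[of w n]
        by (auto simp: seq_dist_def seq_prod_cons 1 step_def word_length_one)
      then show ?thesis by blast
    next
      case 2
      have "seq_dist S (seq_cons ((x, k), i) w) (seq_cons (q (x, k), i) w) \<le> word_length G S (inv s)"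
        if x: "x \<in> carrier G" and w: "w \<in> seqs n" for x k i w
      proof -
        have c: "seq_prod w \<in> carrier G" using w by (rule seq_prod_closed)
        have "x \<otimes> seq_prod w \<otimes> inv (s \<otimes> x \<otimes> seq_prod w) = inv s"
          using x c 2(1) by (simp add: inv_mult_group m_assoc)
            (metis (no_types, opaque_lifting) inv_closed l_one m_assoc m_closed r_inv)
        then show ?thesis
          using x c 2 by (auto simp: seq_dist_def seq_prod_cons half_mult_def word_length_one)
      qed
      then show ?thesis by blast
    qed
  qed
  show "\<exists>C. \<forall>\<omega>\<in>carrier G \<times> UNIV. \<forall>i<n. \<forall>j<n. \<forall>w\<in>seqs n. seq_dist S (seq_cons (\<omega>, i) w) (seq_cons (\<omega>, j) w) \<le> C"
  proof -
    have "seq_dist S (seq_cons (\<omega>, i) w) (seq_cons (\<omega>, j) w) \<le> 0"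
      if "\<omega> \<in> carrier G \<times> UNIV" "w \<in> seqs n" for \<omega> i j w
      using that seq_prod_closed[of w n] by (auto simp: seq_dist_def seq_prod_cons word_length_one)
    then show ?thesis by blast
  qed
  show "\<exists>C. \<forall>i<n. \<forall>w\<in>seqs n. seq_dist S w (seq_cons ((\<one>, 0), i) w) \<le> C"
  proof -
    have "seq_dist S w (seq_cons ((\<one>, 0), i) w) \<le> 0" if "w \<in> seqs n" for i w
      using that seq_prod_closed[of w n] by (auto simp: seq_dist_def seq_prod_cons word_length_one)
    then show ?thesis by blast
  qed
qed

text \<open>Besides the group and the embedding, a length bound \<open>Bd\<close> is exported with
  the properties that \<open>qi_embeddingI\<close> asks for; it is the displacement on
  sequences.\<close>

lemma embeds_undistorted_in_simple:
  assumes S: "fin_gen_set G S"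
  shows "\<exists>(K :: ((('a \<times> int) \<times> nat) list \<Rightarrow> (('a \<times> int) \<times> nat) list) monoid) f a b (Bd :: _ \<Rightarrow> nat \<Rightarrow> bool).
    simple_grp K \<and> countable (carrier K) \<and> a \<in> carrier K \<and> b \<in> carrier K \<and> generate K {a, b} = carrier K \<and>
    f \<in> hom G K \<and> inj_on f (carrier G) \<and> Bd \<one>\<^bsub>K\<^esub> 0 \<and>
    (\<forall>g\<in>carrier K. \<forall>g'\<in>carrier K. \<forall>c c'. Bd g c \<longrightarrow> Bd g' c' \<longrightarrow> Bd (g \<otimes>\<^bsub>K\<^esub> g') (c + c')) \<and>
    (\<forall>g c c'. Bd g c \<longrightarrow> c \<le> c' \<longrightarrow> Bd g c') \<and> (\<forall>g\<in>carrier K. \<exists>c. Bd g c) \<and>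
    (\<forall>h\<in>carrier G. \<forall>c. Bd (f h) c \<longrightarrow> word_length G S h \<le> c)"
proof -
  define n where "n = 18 * 2 ^ ((card (letter_perms S) + 3) * card three_cyc) + (9::nat)"
  interpret tower "carrier G \<times> UNIV" "(\<one>, 0)" "letter_perms S" n "seqs n" seq_cons "seq_dist S"
    using tower_seqs[OF S n_def] .
  have S': "S \<subseteq> carrier G" "generate G S = carrier G" using S unfolding fin_gen_set_def by auto
  define K where "K = perm_grp\<lparr>carrier := \<Gamma>\<rparr>"
  \<comment> \<open>The action of \<open>h\<close> on level 0 of class 0. As
    \<open>zero_mult h\<close> is a commutator, \<open>commutator_at_class\<close> puts it into
    \<open>\<Gamma>\<close>.\<close>
  define f where "f = (\<lambda>h. lift (at_class (zero_mult h) 0))"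
  define Bd where "Bd = (\<lambda>g c. \<forall>z\<in>seqs n. seq_dist S z (g z) \<le> c)"
  obtain a where a: "a \<in> \<Gamma>" "generate perm_grp {a, shift 1} = \<Gamma>" using two_generated by blast
  have nil: "[] \<in> seqs n" unfolding seqs_def by simp
  have half: "half_mult h \<in> generate perm_grp (letter_perms S)" if "h \<in> carrier G" for h
    using half_mult_generate S' that by simp
  have f_\<Gamma>: "f h \<in> \<Gamma>" if "h \<in> carrier G" for h
    unfolding f_def zero_mult_eq_comm[OF that]
    using half[OF that] step_generate[OF S'(1)] by (rule commutator_at_class)
  \<comment> \<open>The empty list is the constant base sequence, and the first letter of its image
    reveals \<open>h\<close>. This gives injectivity as well as the lower bound on
    displacement.\<close>
  have f_nil: "f h [] = seq_cons ((h, 0), 0) []" if "h \<in> carrier G" for h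
  proof -
    have "f h [] = f h (seq_cons ((\<one>, 0), 0) [])" by (simp add: seq_cons_def)
    also have "\<dots> = seq_cons ((h, 0), 0) []"
      unfolding f_def using nil that n_ge by (subst lift_cons) (auto simp: zero_mult_def)
    finally show ?thesis .
  qed
  have K_simple: "simple_grp K" unfolding K_def by (rule simple_\<Gamma>)
  have K_countable: "countable (carrier K)"
    unfolding K_def \<Gamma>_def using countable_generate[OF group_perm_grp, of "insert (shift 1) E"] finite_E gens_bij
    by simp
  have K_gens: "generate K {a, shift 1} = carrier K"
    using perm.generate_consistent[OF _ subgroup_\<Gamma>, of "{a, shift 1}"] a shift_\<Gamma> unfolding K_def by simp
  have K_hom: "f \<in> hom G K"
  proof (rule homI)
    fix h h' assume h: "h \<in> carrier G" "h' \<in> carrier G"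
    have "zero_mult h' \<in> stab (carrier G \<times> UNIV)"
      unfolding zero_mult_eq_comm[OF h(2)] comm_def
      by (intro stab_comp stab_pinv half_mult_stab step_stab h)
    then have "f (h \<otimes> h') = f h \<circ> f h'"
      unfolding f_def zero_mult_comp[OF h, symmetric] at_class_comp by (intro lift_comp at_class_stab)
    then show "f (h \<otimes> h') = f h \<otimes>\<^bsub>K\<^esub> f h'" unfolding K_def by simp
  qed (simp add: K_def f_\<Gamma>)
  have K_inj: "inj_on f (carrier G)"
  proof (rule inj_onI)
    fix h h' assume h: "h \<in> carrier G" "h' \<in> carrier G" "f h = f h'"
    then have "seq_cons ((h, 0), 0) [] = seq_cons ((h', 0), 0) []" using f_nil by metis
    then show "h = h'" using h nil n_ge by simp
  qed
  have K_one: "Bd \<one>\<^bsub>K\<^esub> 0" unfolding Bd_def K_def by (simp add: d_refl)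
  have K_mult: "Bd (g \<otimes>\<^bsub>K\<^esub> g') (c + c')" if "g \<in> carrier K" "g' \<in> carrier K" "Bd g c" "Bd g' c'" for g g' c c'
  proof -
    have stab: "g \<in> stab (seqs n)" "g' \<in> stab (seqs n)"
      using that \<Gamma>_prefix_maps prefix_maps_stab unfolding K_def by auto
    have g: "g z \<in> seqs n" "g' z \<in> seqs n" if "z \<in> seqs n" for z
      using stab_mem[OF stab(1) that] stab_mem[OF stab(2) that] .
    have "seq_dist S z (g (g' z)) \<le> c + c'" if z: "z \<in> seqs n" for z
      using d_tri[OF z g(2)[OF z] g(1)[OF g(2)[OF z]]] \<open>Bd g c\<close> \<open>Bd g' c'\<close> z g(2)[OF z]
      unfolding Bd_def by fastforce
    then show ?thesis unfolding Bd_def K_def by simp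
  qed
  have K_mono: "\<forall>g c c'. Bd g c \<longrightarrow> c \<le> c' \<longrightarrow> Bd g c'" unfolding Bd_def using le_trans by blast
  have K_ex: "\<forall>g\<in>carrier K. \<exists>c. Bd g c" unfolding Bd_def K_def using \<Gamma>_bounded unfolding bounded_disp_def by auto
  have K_word: "word_length G S h \<le> c" if h: "h \<in> carrier G" and Bd: "Bd (f h) c" for h c
  proof -
    have le: "seq_dist S [] (f h []) \<le> c" using Bd nil unfolding Bd_def by blast
    moreover have "seq_dist S [] (f h []) = word_length G S (inv h)"
      unfolding f_nil[OF h] seq_dist_def seq_prod_cons using h by (simp add: seq_prod_def)
    ultimately show ?thesis using word_length_inv[OF S h] by simp
  qed
  have K_mem: "a \<in> carrier K" "shift 1 \<in> carrier K" unfolding K_def using a shift_\<Gamma> by simp_all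
  show ?thesis
  proof (rule exI[of _ K], rule exI[of _ f], rule exI[of _ a], rule exI[of _ "shift 1"], rule exI[of _ Bd],
      intro conjI ballI allI impI)
    show "simple_grp K" "countable (carrier K)" "generate K {a, shift 1} = carrier K"
      "f \<in> hom G K" "inj_on f (carrier G)" "a \<in> carrier K" "shift 1 \<in> carrier K" "Bd \<one>\<^bsub>K\<^esub> 0"
      by fact+
    show "Bd (g \<otimes>\<^bsub>K\<^esub> g') (c + c')"
      if "g \<in> carrier K" "g' \<in> carrier K" "Bd g c" "Bd g' c'" for g g' c c'
      using K_mult that .
    show "Bd g c'" if "Bd g c" "c \<le> c'" for g c c' using K_mono that by blast
    show "\<exists>c. Bd g c" if "g \<in> carrier K" for g using K_ex that by blast
    show "word_length G S h \<le> c" if "h \<in> carrier G" "Bd (f h) c" for h c using K_word that .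
  qed
qed

end

theorem theoremC:
  fixes H :: "('a, 'b) monoid_scheme"
  assumes "group H" and "finitely_generated H"
  shows "\<exists>(G :: nat monoid) f a b.
           simple_grp G \<and> a \<in> carrier G \<and> b \<in> carrier G \<and> generate G {a, b} = carrier G \<and>
           f \<in> hom H G \<and> inj_on f (carrier H) \<and>
           (\<forall>S T. fin_gen_set H S \<longrightarrow> fin_gen_set G T \<longrightarrow> qi_embedding H S G T f)"
proof -
  interpret H: group H by fact
  \<comment> \<open>One fixed generating set serves for the construction; arbitrary \<open>S\<close>
    and \<open>T\<close> are compared with it through \<open>qi_embeddingI\<close>.\<close>
  obtain S0 where S0: "fin_gen_set H S0" using assms(2) unfolding finitely_generated_def by blast
  obtain K :: "((('a \<times> int) \<times> nat) list \<Rightarrow> (('a \<times> int) \<times> nat) list) monoid" and f a b and Bd :: "_ \<Rightarrow> nat \<Rightarrow> bool"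
    where K: "simple_grp K" "countable (carrier K)"
    and ab: "a \<in> carrier K" "b \<in> carrier K" "generate K {a, b} = carrier K"
    and f: "f \<in> hom H K" "inj_on f (carrier H)"
    and Bd: "Bd \<one>\<^bsub>K\<^esub> 0"
      "\<forall>g\<in>carrier K. \<forall>g'\<in>carrier K. \<forall>c c'. Bd g c \<longrightarrow> Bd g' c' \<longrightarrow> Bd (g \<otimes>\<^bsub>K\<^esub> g') (c + c')"
      "\<forall>g c c'. Bd g c \<longrightarrow> c \<le> c' \<longrightarrow> Bd g c'" "\<forall>g\<in>carrier K. \<exists>c. Bd g c"
      "\<forall>h\<in>carrier H. \<forall>c. Bd (f h) c \<longrightarrow> word_length H S0 h \<le> c"
    using H.embeds_undistorted_in_simple[OF S0] by (elim exE conjE) (rule that)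
  interpret K: group K using K(1) unfolding simple_grp_def by simp
  obtain G :: "nat monoid" and \<phi> where G: "group G" and \<phi>: "\<phi> \<in> iso K G"
    using countable_group_iso_nat[OF K.is_group K(2)] .
  interpret G: group G by fact
  interpret \<phi>: group_hom K G \<phi> using \<phi> by unfold_locales (simp add: iso_def)
  let ?\<psi> = "inv_into (carrier K) \<phi>"
  have inv: "?\<psi> \<in> iso G K" using K.iso_set_sym[OF \<phi>] .
  interpret \<psi>: group_hom G K ?\<psi> using inv by unfold_locales (simp add: iso_def)
  have bij: "bij_betw \<phi> (carrier K) (carrier G)" using \<phi> unfolding iso_def by simp
  then have \<psi>\<phi>: "?\<psi> (\<phi> k) = k" if "k \<in> carrier K" for k using that by (simp add: bij_betw_inv_into_left)
  have f_K: "f h \<in> carrier K" if "h \<in> carrier H" for h using f(1) that by (auto simp: hom_def)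
  have hom: "\<phi> \<circ> f \<in> hom H G" using f(1) f_K by (auto simp: hom_def)
  have "simple_grp G" using simple_grp_iso[OF K(1) G \<phi>] .
  moreover have "generate G {\<phi> a, \<phi> b} = carrier G"
    using \<phi>.generate_img[of "{a, b}"] ab bij by (simp add: bij_betw_def)
  moreover have "inj_on (\<phi> \<circ> f) (carrier H)"
    using f(2) bij f_K unfolding bij_betw_def by (intro comp_inj_on) (auto intro: inj_on_subset)
  moreover have "qi_embedding H S G T (\<phi> \<circ> f)" if "fin_gen_set H S" "fin_gen_set G T" for S T
  \<comment> \<open>Elements of \<open>G\<close> are measured by their displacement in
    \<open>K\<close>, read through the inverse isomorphism.\<close>
  proof (rule qi_embeddingI[OF assms(1) G hom that(1) S0 that(2), where Bd = "\<lambda>g. Bd (?\<psi> g)"])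
    fix g g' c c' assume "g \<in> carrier G" "g' \<in> carrier G" "Bd (?\<psi> g) c" "Bd (?\<psi> g') c'"
    then show "Bd (?\<psi> (g \<otimes>\<^bsub>G\<^esub> g')) (c + c')" using Bd(2) by simp
  next
    fix h c assume "h \<in> carrier H" "Bd (?\<psi> ((\<phi> \<circ> f) h)) c"
    then show "word_length H S0 h \<le> c" using Bd(5) \<psi>\<phi> f_K by simp
  qed (use Bd in \<open>auto simp del: \<psi>.hom_one simp: \<psi>.hom_one\<close>)
  ultimately show ?thesis using hom ab(1,2) \<phi>.hom_closed by blast
qed

end
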